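(* Let $\mathcal{A}=(A_n)_{n\in\mathbb{Z}}$ be a homogeneous Poisson process on $\mathbb{R}$ of intensity $\lambda>0$, with points numbered increasingly so that $A_0<0<A_1$. Let $s=(s_n)_{n\in\mathbb{Z}}$ be i.i.d. exponential random variables of parameter $\mu$, independent of $\mathcal{A}$, and assume $\lambda<\mu$. Define $$D_n=\sup_{k\le n}\Big[A_k+\sum_{i=k}^n s_i\Big],\qquad r_n=\min(D_n,A_{n+1})-A_n,\qquad n\in\mathbb{Z}$$ (the $D_n$ are almost surely finite). Then the marked point process $(\mathcal{D},r)$, i.e. the random configuration $\{(D_n,r_n):n\in\mathbb{Z}\}$ (point $D_n$ carrying mark $r_n$), has the same law as the marked point process $(\mathcal{A},s)$, i.e. the random configuration $\{(A_n,s_n):n\in\mathbb{Z}\}$.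
   Context: Interpretation (not needed for the statement): in a FIFO single-server queue with arrival times $A_n$ and service times $s_n$, $D_n$ is the departure time of customer $n$ and $r_n$ the time customer $n$ spends at the very back of the queue. A marked point process is identified with its set of (point, mark) pairs; the numbering of points is irrelevant for its law. *)

theory Defs
  imports "HOL-Probability.Probability"
begin

definition num_points :: "'a set \<Rightarrow> 'a set \<Rightarrow> ennreal"
  where "num_points B X = emeasure (count_space UNIV) (X \<inter> B)"

text \<open>
  The measurable space of configurations carries the usual sigma-algebra, generated by the counting
  maps of Borel sets. The carrier consists of all subsets rather than only the locally finite
  ones, so that a random configuration may misbehave on a null set; on locally finite
  configurations the trace is the standard sigma-algebra.
\<close>

definition config_space :: "'a::topological_space set measure"
  where "config_space =
    sigma UNIV {num_points B -` S | B S. B \<in> sets borel \<and> S \<in> sets borel}"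

text \<open>
  The explicit Poisson weights are used because the library's \<open>poisson_pmf\<close> is only specified
  for positive rates, whereas null sets \<open>B\<close> have rate \<open>0\<close> here. Since the weights sum to
  \<open>1\<close>, the counts of bounded sets are almost surely finite.
\<close>

definition poisson_process :: "'w measure \<Rightarrow> real \<Rightarrow> ('w \<Rightarrow> real set) \<Rightarrow> bool"
  where "poisson_process M l X \<longleftrightarrow>
    X \<in> measurable M config_space \<and>
    (\<forall>B k. B \<in> sets borel \<and> bounded B \<longrightarrow>
      measure M {w \<in> space M. num_points B (X w) = of_nat k} =
        (l * measure lborel B) ^ k / fact k * exp (- (l * measure lborel B))) \<and>
    (\<forall>(I :: nat set) B. finite I \<and> (\<forall>i\<in>I. B i \<in> sets borel \<and> bounded (B i)) \<and>
        disjoint_family_on B I \<longrightarrow>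
      prob_space.indep_vars M (\<lambda>_. borel) (\<lambda>i w. num_points (B i) (X w)) I)"

text \<open>
  The supremum is taken in the extended reals, so that its finiteness is a genuine assertion.
\<close>

definition departure :: "(int \<Rightarrow> real) \<Rightarrow> (int \<Rightarrow> real) \<Rightarrow> int \<Rightarrow> ereal"
  where "departure a s n = (SUP k\<in>{..n}. ereal (a k + (\<Sum>i=k..n. s i)))"

definition back_time :: "(int \<Rightarrow> real) \<Rightarrow> (int \<Rightarrow> real) \<Rightarrow> int \<Rightarrow> real"
  where "back_time a s n = real_of_ereal (min (departure a s n) (ereal (a (n + 1)))) - a n"

definition arrival_config :: "(int \<Rightarrow> real) \<Rightarrow> (int \<Rightarrow> real) \<Rightarrow> (real \<times> real) set"
  where "arrival_config a s = {(a n, s n) | n. True}"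

definition departure_config :: "(int \<Rightarrow> real) \<Rightarrow> (int \<Rightarrow> real) \<Rightarrow> (real \<times> real) set"
  where "departure_config a s = {(real_of_ereal (departure a s n), back_time a s n) | n. True}"

end

theory Submission
  imports Defs
begin

text \<open>
  Work under the Palm measure \<open>Q\<close>, where an arrival sits at \<open>0\<close>, the gaps are i.i.d. exponential of
  parameter \<open>l\<close> and the services i.i.d. exponential of parameter \<open>m\<close>. One step of the queue maps the
  stationary sojourn time, the next gap and the next service to the next sojourn time, the next
  departure gap and the time at the back. This map preserves the product of the three exponential
  laws, and iterating it from a remote past shows that the departure gaps and the back times are
  again distributed as \<open>Q\<close>. To return to the time-stationary process, the law of the arrivals is
  written as \<open>l\<close> times the \<open>Q\<close>-expectation of a Lebesgue integral over the cell from \<open>0\<close> to the next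
  arrival; since both arrivals and departures tile the line and are compatible with the index shift,
  this cell may be exchanged for the one between the departures number \<open>0\<close> and \<open>1\<close>.
\<close>

section \<open>Product measures and exponential laws\<close>

text \<open>The detour through \<open>Q\<close> is forced by size-biasing: in the time-stationary
  process the gap that covers the origin does not have the law of the others, so the gaps are not
  i.i.d. The factor \<open>l\<close> is the reciprocal of the mean gap. The true sojourn time of a
  customer is a function of the path up to that customer, whereas the invariance of one step
  concerns an independent variable \<open>y\<close>, exponential of parameter \<open>m - l\<close>.
  The two are reconciled by attaching \<open>y\<close> at index \<open>- N\<close>: the law of an
  output window is then known for every \<open>N\<close>, and almost surely the window agrees with
  the true output as soon as \<open>N\<close> is large, since the queue forgets its initial value.
  This negative drift is obtained from exponential moments. The hypothesis on the arrivals speaks of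
  counts of sets, not of gaps or indices. The law of the numbered sequence is recovered from events
  saying that given intervals contain no point or exactly one, with the origin in one of the empty
  intervals; their probabilities are explicit both for Poisson counts and for the Palm
  inversion.\<close>

lemma nn_integral_PiM_resample:
  fixes M :: "'i \<Rightarrow> 'a measure"
  assumes M: "\<And>i. prob_space (M i)" and F[measurable]: "F \<in> borel_measurable (PiM UNIV M)"
  shows "(\<integral>\<^sup>+w. F w \<partial>PiM UNIV M) = (\<integral>\<^sup>+w. (\<integral>\<^sup>+x. F (w(k := x)) \<partial>M k) \<partial>PiM UNIV M)"
proof -
  interpret k: prob_space "M k" by (rule M)
  interpret P: prob_space "PiM UNIV M" by (rule prob_space_PiM) (rule M)
  interpret kP: pair_sigma_finite "M k" "PiM UNIV M" ..
  have [measurable]: "(\<lambda>(x, w). w(k := x)) \<in> M k \<Otimes>\<^sub>M PiM UNIV M \<rightarrow>\<^sub>M PiM UNIV M"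
    using measurable_compose[OF measurable_pair_swap'[of "M k" "PiM UNIV M"], of "\<lambda>(f, y). f(k := y)" "PiM UNIV M"]
      measurable_add_dim[of k UNIV M]
    by (simp add: split_beta')
  \<comment> \<open>Overwriting one coordinate by an independent draw of its law leaves the product
    law unchanged. This integrates out a single coordinate without splitting the index set.\<close>
  have "(\<integral>\<^sup>+w. F w \<partial>PiM UNIV M) = (\<integral>\<^sup>+w. F w \<partial>distr (M k \<Otimes>\<^sub>M PiM UNIV M) (PiM UNIV M) (\<lambda>(x, w). w(k := x)))"
    using distr_pair_PiM_eq_PiM[of UNIV M k] M by simp
  also have "\<dots> = (\<integral>\<^sup>+p. F ((snd p)(k := fst p)) \<partial>(M k \<Otimes>\<^sub>M PiM UNIV M))"
    by (subst nn_integral_distr) (auto simp: split_beta')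
  also have "\<dots> = (\<integral>\<^sup>+w. (\<integral>\<^sup>+x. F (w(k := x)) \<partial>M k) \<partial>PiM UNIV M)"
    by (subst kP.nn_integral_snd[symmetric]) (auto simp: split_beta')
  finally show ?thesis .
qed

lemma nn_integral_PiM_prod:
  fixes M :: "'i \<Rightarrow> 'a measure" and f :: "'i \<Rightarrow> 'a \<Rightarrow> ennreal"
  assumes M: "\<And>i. prob_space (M i)" and J: "finite J"
    and f[measurable]: "\<And>i. f i \<in> borel_measurable (M i)"
  shows "(\<integral>\<^sup>+w. (\<Prod>i\<in>J. f i (w i)) \<partial>PiM UNIV M) = (\<Prod>i\<in>J. \<integral>\<^sup>+x. f i x \<partial>M i)"
  using J
proof induction
  case empty
  interpret P: prob_space "PiM UNIV M" by (rule prob_space_PiM) (rule M)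
  show ?case by (simp add: P.emeasure_space_1)
next
  case (insert k J)
  have *: "(\<Prod>i\<in>J. f i (if i = k then x else w i)) = (\<Prod>i\<in>J. f i (w i))" for w x
    using insert by (intro prod.cong) auto
  have "(\<integral>\<^sup>+w. (\<Prod>i\<in>insert k J. f i (w i)) \<partial>PiM UNIV M) =
      (\<integral>\<^sup>+w. (\<integral>\<^sup>+x. f k x * (\<Prod>i\<in>J. f i (w i)) \<partial>M k) \<partial>PiM UNIV M)"
    using insert by (subst nn_integral_PiM_resample[OF M, where k = k]) (auto simp: * )
  also have "\<dots> = (\<integral>\<^sup>+w. (\<integral>\<^sup>+x. f k x \<partial>M k) * (\<Prod>i\<in>J. f i (w i)) \<partial>PiM UNIV M)"
    by (simp add: nn_integral_multc)
  also have "\<dots> = (\<Prod>i\<in>insert k J. \<integral>\<^sup>+x. f i x \<partial>M i)"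
    using insert by (subst nn_integral_cmult) auto
  finally show ?case .
qed

section \<open>Exponential laws: tilting, tails and weighted integrals\<close>

definition expo :: "real \<Rightarrow> real measure"
  where "expo r = density lborel (exponential_density r)"

lemma sets_expo [simp, measurable_cong]: "sets (expo r) = sets borel"
  by (simp add: expo_def)

lemma space_expo [simp]: "space (expo r) = UNIV"
  by (simp add: expo_def)

lemma prob_space_expo: "0 < r \<Longrightarrow> prob_space (expo r)"
  unfolding expo_def by (rule prob_space_exponential_density)

lemma nn_integral_expo:
  assumes "0 < r" and [measurable]: "f \<in> borel_measurable borel"
  shows "(\<integral>\<^sup>+x. f x \<partial>expo r) = (\<integral>\<^sup>+x. ennreal (r * exp (- (r * x))) * indicator {0..} x * f x \<partial>lborel)"
proof -
  have "ennreal (exponential_density r x) * f x = ennreal (r * exp (- (r * x))) * indicator {0..} x * f x" for x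
    by (cases "x < 0") (simp_all add: exponential_density_def mult.commute[of x])
  then show ?thesis
    unfolding expo_def using assms by (subst nn_integral_density) auto
qed

lemma AE_expo_pos: "0 < r \<Longrightarrow> AE x in expo r. 0 < x"
proof -
  have "AE x in lborel. 0 < ennreal (exponential_density r x) \<longrightarrow> 0 < x"
    using AE_lborel_singleton[of 0]
    by eventually_elim (auto simp: exponential_density_def split: if_splits)
  then show ?thesis
    unfolding expo_def by (subst AE_density) auto
qed

text \<open>Exponential tilting: the factor \<open>exp (c * x)\<close> turns the density of rate
  \<open>r\<close> into \<open>r / (r - c)\<close> times the density of rate \<open>r - c\<close>,
  which has mass one.\<close>

lemma nn_integral_expo_exp:
  assumes "0 < r" "c < r"
  shows "(\<integral>\<^sup>+x. ennreal (exp (c * x)) \<partial>expo r) = ennreal (r / (r - c))"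
proof -
  interpret prob_space "expo (r - c)" using assms by (intro prob_space_expo) simp
  have "(\<integral>\<^sup>+x. ennreal (exp (c * x)) \<partial>expo r) =
      (\<integral>\<^sup>+x. ennreal (r / (r - c)) * (ennreal ((r - c) * exp (- ((r - c) * x))) * indicator {0..} x * 1) \<partial>lborel)"
    using assms by (subst nn_integral_expo)
      (auto intro!: nn_integral_cong split: split_indicator simp: ennreal_mult'[symmetric] exp_add[symmetric] exp_diff exp_minus field_simps)
  also have "\<dots> = ennreal (r / (r - c)) * (\<integral>\<^sup>+x. 1 \<partial>expo (r - c))"
    using assms by (subst nn_integral_expo) (auto simp: nn_integral_cmult)
  finally show ?thesis using emeasure_space_1 by simp
qed

lemma emeasure_expo_greaterThan:
  assumes "0 < r" "0 \<le> a"
  shows "emeasure (expo r) {a<..} = ennreal (exp (- (r * a)))"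
proof -
  interpret prob_space "expo r" using assms by (intro prob_space_expo)
  have "distributed (expo r) lborel (\<lambda>x. x) (exponential_density r)"
    unfolding distributed_def using assms by (auto simp: expo_def distr_id2 exponential_density_nonneg)
  from exponential_distributedD_gt[OF this assms(2,1)] show ?thesis
    by (simp add: emeasure_eq_measure greaterThan_def mult.commute)
qed

text \<open>The weight cancels the exponential factor of the density and leaves \<open>r\<close>
  times Lebesgue measure. This is how a gap confined to an interval contributes rate times
  length.\<close>

lemma nn_integral_expo_exp_box:
  assumes "0 < r" "0 \<le> a" "a \<le> b"
  shows "(\<integral>\<^sup>+x. indicator {a<..b} x * ennreal (exp (r * x)) \<partial>expo r) = ennreal (r * (b - a))"
proof -
  have "(\<integral>\<^sup>+x. indicator {a<..b} x * ennreal (exp (r * x)) \<partial>expo r) =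
      (\<integral>\<^sup>+x. ennreal r * indicator {a<..b} x \<partial>lborel)"
    using assms by (subst nn_integral_expo)
      (auto intro!: nn_integral_cong split: split_indicator simp: ennreal_mult'[symmetric] exp_minus)
  then show ?thesis using assms by (simp add: nn_integral_cmult ennreal_mult)
qed

text \<open>Reflection at \<open>a\<close> brings back the density of \<open>expo r\<close>. Used to
  integrate over the position of the leftmost constrained arrival.\<close>

lemma nn_integral_lborel_exp_atMost:
  assumes "0 < r"
  shows "(\<integral>\<^sup>+x. indicator {..a} x * ennreal (exp (r * x)) \<partial>lborel) = ennreal (exp (r * a) / r)"
proof -
  interpret prob_space "expo r" using assms by (intro prob_space_expo)
  have "(\<integral>\<^sup>+x. indicator {..a} x * ennreal (exp (r * x)) \<partial>lborel) =
      (\<integral>\<^sup>+x. indicator {..a} (a + (-1) * x) * ennreal (exp (r * (a + (-1) * x))) \<partial>lborel)"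
    by (subst nn_integral_real_affine[where c = "-1" and t = a]) auto
  also have "\<dots> = (\<integral>\<^sup>+x. ennreal (exp (r * a) / r) * (ennreal (r * exp (- (r * x))) * indicator {0..} x * 1) \<partial>lborel)"
    using assms by (auto intro!: nn_integral_cong split: split_indicator
        simp: ennreal_mult'[symmetric] exp_add[symmetric] right_diff_distrib exp_diff exp_minus field_simps)
  also have "\<dots> = ennreal (exp (r * a) / r) * (\<integral>\<^sup>+x. 1 \<partial>expo r)"
    using assms by (subst nn_integral_expo) (auto simp: nn_integral_cmult)
  finally show ?thesis using emeasure_space_1 by simp
qed

lemma nn_integral_lborel_shift:
  fixes f :: "real \<Rightarrow> ennreal"
  assumes [measurable]: "f \<in> borel_measurable borel"
  shows "(\<integral>\<^sup>+x. f (x + c) \<partial>lborel) = (\<integral>\<^sup>+x. f x \<partial>lborel)"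
  using nn_integral_real_affine[OF assms, of 1 c] by (simp add: add.commute)

section \<open>Invariance of three exponential laws under one queue step\<close>

lemma nn_integral_lborel_reverse3:
  fixes K :: "real \<times> real \<times> real \<Rightarrow> ennreal"
  assumes [measurable]: "K \<in> borel_measurable (borel \<Otimes>\<^sub>M borel \<Otimes>\<^sub>M borel)"
  shows "(\<integral>\<^sup>+x. \<integral>\<^sup>+y. \<integral>\<^sup>+z. K (x, y, z) \<partial>lborel \<partial>lborel \<partial>lborel) =
    (\<integral>\<^sup>+z. \<integral>\<^sup>+y. \<integral>\<^sup>+x. K (x, y, z) \<partial>lborel \<partial>lborel \<partial>lborel)"
proof -
  have "(\<integral>\<^sup>+x. \<integral>\<^sup>+y. \<integral>\<^sup>+z. K (x, y, z) \<partial>lborel \<partial>lborel \<partial>lborel) =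
      (\<integral>\<^sup>+x. \<integral>\<^sup>+z. \<integral>\<^sup>+y. K (x, y, z) \<partial>lborel \<partial>lborel \<partial>lborel)"
    by (intro nn_integral_cong lborel_pair.Fubini') measurable
  also have "\<dots> = (\<integral>\<^sup>+z. \<integral>\<^sup>+x. \<integral>\<^sup>+y. K (x, y, z) \<partial>lborel \<partial>lborel \<partial>lborel)"
    by (intro lborel_pair.Fubini') measurable
  also have "\<dots> = (\<integral>\<^sup>+z. \<integral>\<^sup>+y. \<integral>\<^sup>+x. K (x, y, z) \<partial>lborel \<partial>lborel \<partial>lborel)"
    by (intro nn_integral_cong lborel_pair.Fubini') measurable
  finally show ?thesis .
qed

lemma nn_integral_expo3:
  fixes F :: "real \<times> real \<times> real \<Rightarrow> ennreal"
  assumes "0 < a" "0 < b" "0 < c"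
    and [measurable]: "F \<in> borel_measurable (borel \<Otimes>\<^sub>M borel \<Otimes>\<^sub>M borel)"
  shows "(\<integral>\<^sup>+x. \<integral>\<^sup>+y. \<integral>\<^sup>+z. F (x, y, z) \<partial>expo c \<partial>expo b \<partial>expo a) =
    (\<integral>\<^sup>+x. \<integral>\<^sup>+y. \<integral>\<^sup>+z. ennreal (a * b * c * exp (- (a * x + b * y + c * z))) *
      (indicator {0..} x * indicator {0..} y * indicator {0..} z) * F (x, y, z) \<partial>lborel \<partial>lborel \<partial>lborel)"
proof -
  interpret c: prob_space "expo c" using assms by (intro prob_space_expo)
  interpret b: prob_space "expo b" using assms by (intro prob_space_expo)
  have "(\<integral>\<^sup>+x. \<integral>\<^sup>+y. \<integral>\<^sup>+z. F (x, y, z) \<partial>expo c \<partial>expo b \<partial>expo a) =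
    (\<integral>\<^sup>+x. ennreal (a * exp (- (a * x))) * indicator {0..} x *
      (\<integral>\<^sup>+y. ennreal (b * exp (- (b * y))) * indicator {0..} y *
        (\<integral>\<^sup>+z. ennreal (c * exp (- (c * z))) * indicator {0..} z * F (x, y, z) \<partial>lborel) \<partial>lborel) \<partial>lborel)"
    using assms by (simp add: nn_integral_expo)
  also have "\<dots> = (\<integral>\<^sup>+x. \<integral>\<^sup>+y. \<integral>\<^sup>+z. ennreal (a * exp (- (a * x))) * indicator {0..} x *
      (ennreal (b * exp (- (b * y))) * indicator {0..} y *
        (ennreal (c * exp (- (c * z))) * indicator {0..} z * F (x, y, z))) \<partial>lborel \<partial>lborel \<partial>lborel)"
    by (simp add: nn_integral_cmult)
  also have "\<dots> = (\<integral>\<^sup>+x. \<integral>\<^sup>+y. \<integral>\<^sup>+z. ennreal (a * b * c * exp (- (a * x + b * y + c * z))) *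
      (indicator {0..} x * indicator {0..} y * indicator {0..} z) * F (x, y, z) \<partial>lborel \<partial>lborel \<partial>lborel)"
  proof (intro nn_integral_cong)
    fix x y z :: real
    have "exp (- (a * x + b * y + c * z)) = exp (- (a * x)) * (exp (- (b * y)) * exp (- (c * z)))"
      by (simp only: exp_add[symmetric]) (simp add: algebra_simps)
    then have "ennreal (a * b * c * exp (- (a * x + b * y + c * z))) =
        ennreal (a * exp (- (a * x)) * (b * exp (- (b * y))) * (c * exp (- (c * z))))"
      by (simp only: mult_ac)
    also have "\<dots> = ennreal (a * exp (- (a * x))) * ennreal (b * exp (- (b * y))) * ennreal (c * exp (- (c * z)))"
      using assms by (simp only: ennreal_mult' ennreal_mult'' mult_nonneg_nonneg exp_ge_zero less_imp_le)
    finally show "ennreal (a * exp (- (a * x))) * indicator {0..} x *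
      (ennreal (b * exp (- (b * y))) * indicator {0..} y *
        (ennreal (c * exp (- (c * z))) * indicator {0..} z * F (x, y, z))) =
       ennreal (a * b * c * exp (- (a * x + b * y + c * z))) *
      (indicator {0..} x * indicator {0..} y * indicator {0..} z) * F (x, y, z)"
      by (simp add: mult.assoc split: split_indicator)
  qed
  finally show ?thesis .
qed

text \<open>The first two components of the image differ by \<open>x - y\<close>, so the map
  preserves the regions \<open>y \<le> x\<close> and \<open>x < y\<close>. On the first it sends
  \<open>(x, y, z)\<close> to \<open>(x - y + z, z, y)\<close>, and \<open>supp\<close> confines
  both integrals to that region.\<close>

lemma nn_integral_expo_swap_ge:
  fixes F :: "real \<times> real \<times> real \<Rightarrow> ennreal"
  assumes ab: "0 < a" "a < b"
    and F[measurable]: "F \<in> borel_measurable (borel \<Otimes>\<^sub>M borel \<Otimes>\<^sub>M borel)"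
    and supp: "\<And>x y z. x < y \<Longrightarrow> F (x, y, z) = 0"
  shows "(\<integral>\<^sup>+x. \<integral>\<^sup>+y. \<integral>\<^sup>+z. F (max (x - y) 0 + z, max (y - x) 0 + z, min x y) \<partial>expo b \<partial>expo a \<partial>expo (b - a)) =
    (\<integral>\<^sup>+x. \<integral>\<^sup>+y. \<integral>\<^sup>+z. F (x, y, z) \<partial>expo b \<partial>expo a \<partial>expo (b - a))" (is "?L = ?R")
proof -
  let ?i = "indicator {0..} :: real \<Rightarrow> ennreal"
  \<comment> \<open>With \<open>u = x - y\<close> the exponent
    \<open>(b - a) * x + a * y + b * z\<close> becomes \<open>(b - a) * u + b * y + b * z\<close>.
    The parameter \<open>b - a\<close> of the sojourn time is the one that makes it symmetric in
    \<open>y\<close> and \<open>z\<close>.\<close>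
  define H :: "real \<times> real \<times> real \<Rightarrow> ennreal" where "H = (\<lambda>(u, y, z). ennreal ((b - a) * a * b * exp (- ((b - a) * u + b * y + b * z))) * (?i u * ?i y * ?i z))"
  have [measurable]: "H \<in> borel_measurable (borel \<Otimes>\<^sub>M borel \<Otimes>\<^sub>M borel)"
    unfolding H_def by measurable
  have "?L = (\<integral>\<^sup>+x. \<integral>\<^sup>+y. \<integral>\<^sup>+z. H (x - y, y, z) * F (x - y + z, z, y) \<partial>lborel \<partial>lborel \<partial>lborel)"
    using ab
    by (subst nn_integral_expo3[of "b - a" a b "\<lambda>(x, y, z). F (max (x - y) 0 + z, max (y - x) 0 + z, min x y)", simplified])
      (auto intro!: nn_integral_cong simp: H_def algebra_simps max_def min_def supp split: split_indicator)
  also have "\<dots> = (\<integral>\<^sup>+y. \<integral>\<^sup>+x. \<integral>\<^sup>+z. H (x - y, y, z) * F (x - y + z, z, y) \<partial>lborel \<partial>lborel \<partial>lborel)"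
    by (intro lborel_pair.Fubini') measurable
  also have "\<dots> = (\<integral>\<^sup>+y. \<integral>\<^sup>+u. \<integral>\<^sup>+z. H (u, y, z) * F (u + z, z, y) \<partial>lborel \<partial>lborel \<partial>lborel)"
    using nn_integral_lborel_shift[of "\<lambda>u. \<integral>\<^sup>+z. H (u, y, z) * F (u + z, z, y) \<partial>lborel" "- y" for y]
    by simp
  also have "\<dots> = (\<integral>\<^sup>+z. \<integral>\<^sup>+u. \<integral>\<^sup>+y. H (u, y, z) * F (u + z, z, y) \<partial>lborel \<partial>lborel \<partial>lborel)"
    by (rule nn_integral_lborel_reverse3[of "\<lambda>(y, u, z). H (u, y, z) * F (u + z, z, y)", simplified]) measurable
  \<comment> \<open>Symmetry of \<open>H\<close> in its last two arguments: the minimum and the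
    service exchange roles.\<close>
  also have "\<dots> = (\<integral>\<^sup>+z. \<integral>\<^sup>+u. \<integral>\<^sup>+y. H (u, z, y) * F (u + z, z, y) \<partial>lborel \<partial>lborel \<partial>lborel)"
    by (simp add: H_def algebra_simps)
  also have "\<dots> = (\<integral>\<^sup>+y. \<integral>\<^sup>+x. \<integral>\<^sup>+z. H (x - y, y, z) * F (x, y, z) \<partial>lborel \<partial>lborel \<partial>lborel)"
    using nn_integral_lborel_shift[of "\<lambda>u. \<integral>\<^sup>+z. H (u, y, z) * F (u + y, y, z) \<partial>lborel" "- y" for y]
    by simp
  also have "\<dots> = (\<integral>\<^sup>+x. \<integral>\<^sup>+y. \<integral>\<^sup>+z. H (x - y, y, z) * F (x, y, z) \<partial>lborel \<partial>lborel \<partial>lborel)"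
    by (intro lborel_pair.Fubini') measurable
  also have "\<dots> = ?R"
    using ab
    by (subst nn_integral_expo3)
      (auto intro!: nn_integral_cong simp: H_def algebra_simps supp split: split_indicator)
  finally show ?thesis .
qed

lemma nn_integral_expo_swap_less:
  fixes F :: "real \<times> real \<times> real \<Rightarrow> ennreal"
  assumes ab: "0 < a" "a < b"
    and F[measurable]: "F \<in> borel_measurable (borel \<Otimes>\<^sub>M borel \<Otimes>\<^sub>M borel)"
    and supp: "\<And>x y z. y \<le> x \<Longrightarrow> F (x, y, z) = 0"
  shows "(\<integral>\<^sup>+x. \<integral>\<^sup>+y. \<integral>\<^sup>+z. F (max (x - y) 0 + z, max (y - x) 0 + z, min x y) \<partial>expo b \<partial>expo a \<partial>expo (b - a)) =
    (\<integral>\<^sup>+x. \<integral>\<^sup>+y. \<integral>\<^sup>+z. F (x, y, z) \<partial>expo b \<partial>expo a \<partial>expo (b - a))" (is "?L = ?R")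
proof -
  let ?i = "indicator {0..} :: real \<Rightarrow> ennreal"
  \<comment> \<open>Here \<open>u = y - x\<close> and the minimum is \<open>x\<close>, so the
    exponent becomes \<open>a * u + b * x + b * z\<close>: the difference now has rate
    \<open>a\<close>, but the minimum and the service still share the rate \<open>b\<close>.\<close>
  define H :: "real \<times> real \<times> real \<Rightarrow> ennreal" where "H = (\<lambda>(u, y, z). ennreal ((b - a) * a * b * exp (- (a * u + b * y + b * z))) * (?i u * ?i y * ?i z))"
  have [measurable]: "H \<in> borel_measurable (borel \<Otimes>\<^sub>M borel \<Otimes>\<^sub>M borel)"
    unfolding H_def by measurable
  have "?L = (\<integral>\<^sup>+x. \<integral>\<^sup>+y. \<integral>\<^sup>+z. H (y - x, x, z) * F (z, y - x + z, x) \<partial>lborel \<partial>lborel \<partial>lborel)"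
    using ab
    by (subst nn_integral_expo3[of "b - a" a b "\<lambda>(x, y, z). F (max (x - y) 0 + z, max (y - x) 0 + z, min x y)", simplified])
      (auto intro!: nn_integral_cong simp: H_def algebra_simps max_def min_def supp split: split_indicator)
  also have "\<dots> = (\<integral>\<^sup>+x. \<integral>\<^sup>+u. \<integral>\<^sup>+z. H (u, x, z) * F (z, u + z, x) \<partial>lborel \<partial>lborel \<partial>lborel)"
    using nn_integral_lborel_shift[of "\<lambda>u. \<integral>\<^sup>+z. H (u, x, z) * F (z, u + z, x) \<partial>lborel" "- x" for x]
    by simp
  also have "\<dots> = (\<integral>\<^sup>+z. \<integral>\<^sup>+u. \<integral>\<^sup>+x. H (u, x, z) * F (z, u + z, x) \<partial>lborel \<partial>lborel \<partial>lborel)"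
    by (rule nn_integral_lborel_reverse3[of "\<lambda>(x, u, z). H (u, x, z) * F (z, u + z, x)", simplified]) measurable
  also have "\<dots> = (\<integral>\<^sup>+x. \<integral>\<^sup>+u. \<integral>\<^sup>+z. H (u, x, z) * F (x, u + x, z) \<partial>lborel \<partial>lborel \<partial>lborel)"
    by (simp add: H_def algebra_simps)
  also have "\<dots> = (\<integral>\<^sup>+x. \<integral>\<^sup>+y. \<integral>\<^sup>+z. H (y - x, x, z) * F (x, y, z) \<partial>lborel \<partial>lborel \<partial>lborel)"
    using nn_integral_lborel_shift[of "\<lambda>u. \<integral>\<^sup>+z. H (u, x, z) * F (x, u + x, z) \<partial>lborel" "- x" for x]
    by simp
  also have "\<dots> = ?R"
    using ab
    by (subst nn_integral_expo3)
      (auto intro!: nn_integral_cong simp: H_def algebra_simps supp split: split_indicator)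
  finally show ?thesis .
qed

text \<open>
  In the coordinates \<open>x - y\<close> and \<open>min x y\<close> the map below exchanges \<open>min x y\<close> and \<open>z\<close>, which are
  both exponential of parameter \<open>b\<close> and independent of \<open>x - y\<close>.
\<close>

lemma nn_integral_expo_swap:
  fixes F :: "real \<times> real \<times> real \<Rightarrow> ennreal"
  assumes ab: "0 < a" "a < b"
    and F[measurable]: "F \<in> borel_measurable (borel \<Otimes>\<^sub>M borel \<Otimes>\<^sub>M borel)"
  shows "(\<integral>\<^sup>+x. \<integral>\<^sup>+y. \<integral>\<^sup>+z. F (max (x - y) 0 + z, max (y - x) 0 + z, min x y) \<partial>expo b \<partial>expo a \<partial>expo (b - a)) =
    (\<integral>\<^sup>+x. \<integral>\<^sup>+y. \<integral>\<^sup>+z. F (x, y, z) \<partial>expo b \<partial>expo a \<partial>expo (b - a))" (is "?L F = ?R F")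
proof -
  interpret a: prob_space "expo a" using assms by (intro prob_space_expo) simp
  interpret b: prob_space "expo b" using assms by (intro prob_space_expo) simp
  define F1 where "F1 = (\<lambda>(x, y, z). F (x, y, z) * (if y \<le> x then 1 else 0))"
  define F2 where "F2 = (\<lambda>(x, y, z). F (x, y, z) * (if x < y then 1 else 0))"
  have [measurable]: "F1 \<in> borel_measurable (borel \<Otimes>\<^sub>M borel \<Otimes>\<^sub>M borel)"
    "F2 \<in> borel_measurable (borel \<Otimes>\<^sub>M borel \<Otimes>\<^sub>M borel)"
    unfolding F1_def F2_def by measurable
  have F: "F p = F1 p + F2 p" for p
    by (cases p) (auto simp: F1_def F2_def)
  have "?L F = ?L F1 + ?L F2"
    by (simp add: F nn_integral_add)
  also have "\<dots> = ?R F1 + ?R F2"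
    using ab
    by (intro arg_cong2[where f = "(+)"] nn_integral_expo_swap_ge nn_integral_expo_swap_less)
      (auto simp: F1_def F2_def)
  also have "\<dots> = ?R F"
    by (simp add: F nn_integral_add)
  finally show ?thesis .
qed

section \<open>Paths of the queue\<close>

text \<open>Palm normalisation, with index \<open>0\<close> at the origin. It is applied to services
  as well, where it turns the service sums in \<open>departure\<close> into differences.\<close>

definition pos :: "(int \<Rightarrow> real) \<Rightarrow> int \<Rightarrow> real"
  where "pos g n = (if 0 \<le> n then (\<Sum>j\<in>{0..<n}. g j) else - (\<Sum>j\<in>{n..<0}. g j))"

lemma pos_0 [simp]: "pos g 0 = 0"
  by (simp add: pos_def)

lemma pos_add_1: "pos g (n + 1) = pos g n + g n"
proof (cases "0 \<le> n")
  case True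
  then have "{0..<n + 1} = insert n {0..<n}" by auto
  with True show ?thesis by (simp add: pos_def)
next
  case False
  then have "{n..<0} = insert n {n + 1..<0}" by auto
  with False show ?thesis by (simp add: pos_def)
qed

lemma pos_1 [simp]: "pos g 1 = g 0"
  using pos_add_1[of g 0] by simp

lemma pos_diff:
  assumes "k \<le> n"
  shows "pos g n - pos g k = (\<Sum>j\<in>{k..<n}. g j)"
  using assms
proof (induction n rule: int_ge_induct)
  case (step n)
  then have "{k..<n + 1} = insert n {k..<n}" by auto
  with step show ?case by (simp add: pos_add_1)
qed simp

lemma pos_unique:
  assumes "f 0 = 0" "\<And>n. f (n + 1) = f n + g n"
  shows "f n = pos g n"
proof (induction n rule: int_induct[where k = 0])
  case (step1 i) then show ?case by (simp add: assms pos_add_1)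
next
  case (step2 i) then show ?case using assms(2)[of "i - 1"] pos_add_1[of g "i - 1"] by simp
qed (simp add: assms)

lemma pos_shift: "pos (\<lambda>j. g (j + k)) n = pos g (n + k) - pos g k"
proof (rule pos_unique[symmetric])
  show "pos g (n + 1 + k) - pos g k = pos g (n + k) - pos g k + g (n + k)" for n
    using pos_add_1[of g "n + k"] by (simp add: add_ac)
qed simp

lemma strict_mono_int_Suc:
  fixes f :: "int \<Rightarrow> real"
  assumes "\<And>n. f n < f (n + 1)"
  shows "strict_mono f"
proof (rule strict_monoI)
  fix m n :: int assume "m < n"
  then have "m + 1 \<le> n" by simp
  then show "f m < f n"
  proof (induction n rule: int_ge_induct)
    case base show ?case by (rule assms)
  next
    case (step n) then show ?case using assms[of n] by simp
  qed
qed

lemma strict_mono_pos: "(\<And>j. 0 < g j) \<Longrightarrow> strict_mono (pos g)"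
  by (rule strict_mono_int_Suc) (simp add: pos_add_1)

section \<open>The Lindley recursion and stable paths\<close>

lemma departure_ge: "ereal (a n + s n) \<le> departure a s n"
  unfolding departure_def by (rule SUP_upper2[of n]) auto

text \<open>Lindley recursion: the term \<open>k = n + 1\<close> is split off, and the last service
  leaves the remaining supremum. It holds in \<open>ereal\<close> because adding a real constant
  commutes with a nonempty supremum.\<close>

lemma departure_add_1:
  "departure a s (n + 1) = max (departure a s n) (ereal (a (n + 1))) + ereal (s (n + 1))"
proof -
  have [simp]: "{..n + 1} = insert (n + 1) {..n}" by auto
  have "(\<Sum>i=k..n + 1. s i) = (\<Sum>i=k..n. s i) + s (n + 1)" if "k \<le> n" for k
  proof -
    have "{k..n + 1} = insert (n + 1) {k..n}" using that by auto
    then show ?thesis by simp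
  qed
  then have "(SUP k\<in>{..n}. ereal (a k + (\<Sum>i=k..n + 1. s i))) =
      (SUP k\<in>{..n}. ereal (a k + (\<Sum>i=k..n. s i)) + ereal (s (n + 1)))"
    by (intro SUP_cong) (auto simp: add.assoc)
  also have "\<dots> = departure a s n + ereal (s (n + 1))"
    unfolding departure_def by (rule SUP_ereal_add_left) auto
  finally show ?thesis
    by (simp add: departure_def[of a s "n + 1"] sup_max)
      (cases "departure a s n"; auto simp: max_def)
qed

lemma departure_translate: "departure (\<lambda>k. a k - t) s n = departure a s n - ereal t"
proof -
  have "departure (\<lambda>k. a k - t) s n = (SUP k\<in>{..n}. ereal (a k + (\<Sum>i=k..n. s i)) + ereal (- t))"
    unfolding departure_def by (intro SUP_cong) auto
  also have "\<dots> = departure a s n + ereal (- t)"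
    unfolding departure_def by (rule SUP_ereal_add_left) auto
  finally show ?thesis by (simp add: minus_ereal_def)
qed

lemma departure_reindex: "departure (\<lambda>k. a (k + j)) (\<lambda>k. s (k + j)) n = departure a s (n + j)"
proof -
  have eq: "{..n + j} = (\<lambda>k. k + j) ` {..n}"
    by (auto simp: image_iff intro!: bexI[of _ "_ - j"])
  have "(\<Sum>i=k..n. s (i + j)) = (\<Sum>i=k + j..n + j. s i)" for k
    by (rule sum.reindex_bij_witness[of _ "\<lambda>i. i - j" "\<lambda>i. i + j"]) auto
  then show ?thesis
    unfolding departure_def eq by (simp add: image_comp comp_def)
qed

text \<open>The almost sure properties from which all pathwise arguments follow. The third clause is
  the drift: the walk \<open>pos g k - pos s k\<close>, whose supremum over the past determines the
  departures, goes to minus infinity as \<open>k\<close> does.\<close>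

definition stable :: "(int \<Rightarrow> real) \<Rightarrow> (int \<Rightarrow> real) \<Rightarrow> bool"
  where "stable g s \<longleftrightarrow> (\<forall>j. 0 < g j) \<and> (\<forall>j. 0 < s j) \<and>
    (\<forall>b. \<exists>k0. \<forall>k\<le>k0. pos g k - pos s k \<le> b) \<and> (\<forall>b. \<exists>k. b < pos g k)"

text \<open>Up to a term depending on \<open>n\<close> only, the departure is the running supremum
  of a single walk, so all its asymptotics can be read off from that walk.\<close>

lemma departure_pos:
  "departure (pos g) s n = (SUP k\<in>{..n}. ereal (pos g k - pos s k)) + ereal (pos s (n + 1))"
proof -
  have "(\<Sum>i=k..n. s i) = pos s (n + 1) - pos s k" if "k \<le> n" for k
  proof -
    have "{k..n} = {k..<n + 1}" by auto
    then show ?thesis using that pos_diff[of k "n + 1" s] by simp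
  qed
  then have "departure (pos g) s n = (SUP k\<in>{..n}. ereal (pos g k - pos s k) + ereal (pos s (n + 1)))"
    unfolding departure_def by (intro SUP_cong) (auto simp: algebra_simps)
  also have "\<dots> = (SUP k\<in>{..n}. ereal (pos g k - pos s k)) + ereal (pos s (n + 1))"
    by (rule SUP_ereal_add_left) auto
  finally show ?thesis .
qed

lemma stable_departure_finite:
  assumes "stable g s"
  shows "\<bar>departure (pos g) s n\<bar> \<noteq> \<infinity>"
proof -
  from assms obtain k0 where k0: "\<And>k. k \<le> k0 \<Longrightarrow> pos g k - pos s k \<le> 0"
    unfolding stable_def by meson
  let ?b = "Max (insert 0 ((\<lambda>k. pos g k - pos s k) ` {k0..n}))"
  have "pos g k - pos s k \<le> ?b" if "k \<le> n" for k
  proof (cases "k \<le> k0")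
    case True
    then have "pos g k - pos s k \<le> 0" by (rule k0)
    also have "0 \<le> ?b" by (rule Max_ge) auto
    finally show ?thesis .
  next
    case False
    with that show ?thesis by (intro Max_ge) auto
  qed
  then have "(SUP k\<in>{..n}. ereal (pos g k - pos s k)) \<le> ereal ?b"
    by (intro SUP_least) auto
  then have "departure (pos g) s n \<noteq> \<infinity>"
    unfolding departure_pos by auto
  moreover have "departure (pos g) s n \<noteq> - \<infinity>"
    using departure_ge[of "pos g" n s] by auto
  ultimately show ?thesis by auto
qed

definition exit_time :: "(int \<Rightarrow> real) \<Rightarrow> (int \<Rightarrow> real) \<Rightarrow> int \<Rightarrow> real"
  where "exit_time g s n = real_of_ereal (departure (pos g) s n)"

lemma ereal_exit_time: "stable g s \<Longrightarrow> ereal (exit_time g s n) = departure (pos g) s n"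
  unfolding exit_time_def by (rule ereal_real') (rule stable_departure_finite)

lemma exit_time_add_1:
  assumes "stable g s"
  shows "exit_time g s (n + 1) = max (exit_time g s n) (pos g (n + 1)) + s (n + 1)"
  using departure_add_1[of "pos g" s n]
  by (simp flip: ereal_exit_time[OF assms] add: ereal_max[symmetric] del: ereal_max)

lemma exit_time_ge: "stable g s \<Longrightarrow> pos g n + s n \<le> exit_time g s n"
  using departure_ge[of "pos g" n s] by (simp flip: ereal_exit_time)

lemma back_time_exit: "stable g s \<Longrightarrow> back_time (pos g) s n = min (exit_time g s n - pos g n) (g n)"
  by (simp add: back_time_def pos_add_1 flip: ereal_exit_time) (simp add: min_def)

lemma exit_time_less: "stable g s \<Longrightarrow> exit_time g s n < exit_time g s (n + 1)"
  by (simp add: exit_time_add_1 stable_def max_def) (smt (verit))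

text \<open>By \<open>departure_pos\<close> the bounded quantity is the supremum of the walk over
  the past of \<open>n\<close>, so it inherits the drift. It controls the true sojourn time at a
  remote index when that is used as an initial value.\<close>

lemma exit_time_tendsto_bot:
  assumes "stable g s"
  shows "\<exists>k0. \<forall>n\<le>k0. exit_time g s n - pos s (n + 1) \<le> b"
proof -
  from assms obtain k0 where k0: "\<And>k. k \<le> k0 \<Longrightarrow> pos g k - pos s k \<le> b"
    unfolding stable_def by meson
  have "exit_time g s n - pos s (n + 1) \<le> b" if "n \<le> k0" for n
  proof -
    have "(SUP k\<in>{..n}. ereal (pos g k - pos s k)) \<le> ereal b"
      using that by (intro SUP_least) (auto intro: k0)
    then have "ereal (exit_time g s n) \<le> ereal b + ereal (pos s (n + 1))"
      unfolding ereal_exit_time[OF assms] departure_pos by (rule add_right_mono)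
    then show ?thesis by simp
  qed
  then show ?thesis by auto
qed

lemma exit_time_unbounded:
  assumes "stable g s"
  shows "\<exists>n. exit_time g s n \<le> b" "\<exists>n. b < exit_time g s n"
proof -
  obtain k0 where k0: "\<And>n. n \<le> k0 \<Longrightarrow> exit_time g s n - pos s (n + 1) \<le> b"
    using exit_time_tendsto_bot[OF assms] by meson
  \<comment> \<open>Capping the index at \<open>-1\<close> makes \<open>pos s\<close> nonpositive at
    the following index, so the bound on the difference becomes a bound on the departure
    itself.\<close>
  have "pos s (min k0 (- 1) + 1) \<le> pos s 0"
    using assms by (intro strict_mono_leD[OF strict_mono_pos]) (auto simp: stable_def)
  then show "\<exists>n. exit_time g s n \<le> b"
    using k0[of "min k0 (- 1)"] by (intro exI[of _ "min k0 (- 1)"]) simp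
  from assms obtain k where "b < pos g k" "0 < s k"
    unfolding stable_def by blast
  then show "\<exists>n. b < exit_time g s n"
    using exit_time_ge[OF assms, of k] by (intro exI[of _ k]) simp
qed

lemma pos_unbounded:
  assumes "stable g s"
  shows "\<exists>n. pos g n \<le> b"
proof -
  from exit_time_unbounded(1)[OF assms] obtain n where "exit_time g s n \<le> b" ..
  moreover have "0 < s n" using assms by (simp add: stable_def)
  ultimately show ?thesis
    using exit_time_ge[OF assms, of n] by (intro exI[of _ n]) simp
qed

text \<open>The half-open cells of an increasing sequence unbounded on both sides partition the
  line. The sum over cells is an integral over \<open>count_space\<close> in view of
  Tonelli.\<close>

lemma tiling_indicator:
  fixes f :: "int \<Rightarrow> real"
  assumes "strict_mono f" "\<And>b. \<exists>n. f n \<le> b" "\<And>b. \<exists>n. b < f n"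
  shows "(\<integral>\<^sup>+n. indicator {f n..<f (n + 1)} t \<partial>count_space UNIV) = 1"
proof -
  obtain m where m: "f m \<le> t" using assms(2) by blast
  obtain k where k: "t < f k" using assms(3) by blast
  have le: "n < k" if "f n \<le> t" for n
    using that k strict_mono_less[OF assms(1), of n k] by simp
  define n where "n = Max ({m..k} \<inter> {n. f n \<le> t})"
  have "m \<in> {m..k} \<inter> {n. f n \<le> t}"
    using m le[of m] by simp
  then have ne: "{m..k} \<inter> {n. f n \<le> t} \<noteq> {}" by blast
  have n_in: "n \<in> {m..k} \<inter> {n. f n \<le> t}"
    unfolding n_def by (rule Max_in[OF _ ne]) simp
  have "\<not> f (n + 1) \<le> t"
  proof
    assume "f (n + 1) \<le> t"
    then have "n + 1 \<in> {m..k} \<inter> {n. f n \<le> t}"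
      using n_in le[of "n + 1"] by auto
    then have "n + 1 \<le> n"
      unfolding n_def by (intro Max_ge) simp_all
    then show False by simp
  qed
  then have n: "f n \<le> t" "t < f (n + 1)" using n_in by auto
  have "(indicator {f j..<f (j + 1)} t :: ennreal) = indicator {n} j" for j
  proof -
    have "j = n" if "f j \<le> t" "t < f (j + 1)"
      using that n strict_mono_less[OF assms(1), of j "n + 1"] strict_mono_less[OF assms(1), of n "j + 1"]
      by simp
    then have "j \<in> {n} \<longleftrightarrow> t \<in> {f j..<f (j + 1)}" using n by auto
    then show ?thesis unfolding indicator_def by simp
  qed
  then show ?thesis by simp
qed

text \<open>Sojourn time of customer \<open>i + k\<close>, own service included, when customer
  \<open>i\<close> is assigned the sojourn time \<open>y\<close>.\<close>

fun workload :: "(int \<Rightarrow> real) \<Rightarrow> (int \<Rightarrow> real) \<Rightarrow> int \<Rightarrow> real \<Rightarrow> nat \<Rightarrow> real" where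
  "workload g s i y 0 = y"
| "workload g s i y (Suc k) = max (workload g s i y k - g (i + int k)) 0 + s (i + int k + 1)"

lemma workload_nonneg: "0 \<le> y \<Longrightarrow> (\<And>j. 0 \<le> s j) \<Longrightarrow> 0 \<le> workload g s i y k"
  by (induction k) auto

lemma workload_add: "workload g s i y (j + k) = workload g s (i + int j) (workload g s i y j) k"
  by (induction k) (auto simp: algebra_simps)

text \<open>Each step adds an increment and cuts off at a level independent of \<open>y\<close>, so
  the initial value survives only in the free walk. The cut at \<open>0\<close> is absorbed because
  the solution started from \<open>0\<close> is nonnegative.\<close>

lemma workload_eq_max:
  assumes "0 \<le> y" "\<And>j. 0 \<le> s j"
  shows "workload g s i y k = max (y + (pos s (i + int k + 1) - pos s (i + 1)) - (pos g (i + int k) - pos g i))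
    (workload g s i 0 k)"
proof (induction k)
  case (Suc k)
  have p: "pos s (i + int (Suc k) + 1) = pos s (i + int k + 1) + s (i + int k + 1)"
    "pos g (i + int (Suc k)) = pos g (i + int k) + g (i + int k)"
    using pos_add_1[of s "i + int k + 1"] pos_add_1[of g "i + int k"] by (simp_all add: add_ac)
  have "0 \<le> workload g s i 0 k"
    using assms by (intro workload_nonneg) auto
  then show ?case
    unfolding workload.simps p Suc.IH by (simp add: max_def)
qed (use assms in simp)

lemma workload_exit_time:
  assumes "stable g s"
  shows "workload g s i (exit_time g s i - pos g i) k = exit_time g s (i + int k) - pos g (i + int k)"
proof (induction k)
  case (Suc k)
  have *: "i + int (Suc k) = i + int k + 1" by simp
  show ?case
    unfolding workload.simps Suc.IH * exit_time_add_1[OF assms]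
    by (simp add: pos_add_1 max_def)
qed simp

text \<open>
  Loynes coupling: a solution of the workload recursion is the maximum of a walk with negative drift
  and of the solution started from \<open>0\<close>, so the initial workload is eventually forgotten.
\<close>

lemma workload_coalesce:
  assumes st: "stable g s" and y: "0 \<le> y"
  shows "\<exists>k0. \<forall>i\<le>k0. i \<le> n \<and> workload g s i y (nat (n - i)) = exit_time g s n - pos g n"
proof -
  have s: "\<And>j. 0 \<le> s j" "\<And>j. 0 < s j" using st by (auto simp: stable_def less_imp_le)
  \<comment> \<open>For \<open>i\<close> below \<open>k1\<close> the free walk started from
    \<open>y\<close> at \<open>i\<close> is nonpositive at \<open>n\<close>; below \<open>k2\<close>
    the same holds for the walk started from the true sojourn time at \<open>i\<close>. Both
    solutions then equal the one started from \<open>0\<close>.\<close>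
  obtain k1 where k1: "\<And>i. i \<le> k1 \<Longrightarrow> pos g i - pos s i \<le> pos g n - pos s (n + 1) - y"
    using st unfolding stable_def by meson
  obtain k2 where k2: "\<And>i. i \<le> k2 \<Longrightarrow> exit_time g s i - pos s (i + 1) \<le> pos g n - pos s (n + 1)"
    using exit_time_tendsto_bot[OF st] by meson
  have "workload g s i y (nat (n - i)) = exit_time g s n - pos g n"
    if i: "i \<le> min n (min k1 k2)" for i
  proof -
    have n: "i + int (nat (n - i)) = n" using i by simp
    have nn: "0 \<le> workload g s i 0 (nat (n - i))"
      using s by (intro workload_nonneg) auto
    have "0 \<le> exit_time g s i - pos g i"
      using exit_time_ge[OF st, of i] s(1)[of i] by simp
    from workload_eq_max[of _ s g i "nat (n - i)", OF this s(1)]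
    have "exit_time g s n - pos g n = workload g s i 0 (nat (n - i))"
      using k2[of i] i nn unfolding workload_exit_time[OF st] n by simp
    moreover have "workload g s i y (nat (n - i)) = workload g s i 0 (nat (n - i))"
      using workload_eq_max[of y s g i "nat (n - i)", OF y s(1)] k1[of i] i nn s(2)[of i]
      unfolding n by (simp add: pos_add_1[of s i])
    ultimately show ?thesis by simp
  qed
  then show ?thesis by (intro exI[of _ "min n (min k1 k2)"]) auto
qed

section \<open>Burke's theorem under the Palm measure\<close>

lemma measurable_fun_upd_UNIV [measurable (raw)]:
  assumes "f \<in> N \<rightarrow>\<^sub>M PiM UNIV M" "h \<in> N \<rightarrow>\<^sub>M M i"
  shows "(\<lambda>x. (f x)(i := h x)) \<in> N \<rightarrow>\<^sub>M PiM UNIV M"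
  using assms by (intro measurable_fun_upd[of UNIV UNIV]) auto

text \<open>The moments are summable, so the series of \<open>exp (X n w)\<close> is almost surely
  finite and its terms tend to \<open>0\<close>: Chernoff and Borel-Cantelli in one step.\<close>

lemma AE_exp_tendsto_0:
  fixes X :: "nat \<Rightarrow> 'a \<Rightarrow> real"
  assumes [measurable]: "\<And>n. X n \<in> borel_measurable M"
    and le: "\<And>n. (\<integral>\<^sup>+w. ennreal (exp (X n w)) \<partial>M) = ennreal (r ^ n)" and r: "0 \<le> r" "r < 1"
  shows "AE w in M. \<forall>b. \<exists>n0. \<forall>n\<ge>n0. X n w \<le> b"
proof -
  have "(\<integral>\<^sup>+w. (\<Sum>n. ennreal (exp (X n w))) \<partial>M) = (\<Sum>n. ennreal (r ^ n))"
    by (subst nn_integral_suminf) (auto simp: le)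
  also have "\<dots> \<noteq> \<infinity>"
    using r by (subst suminf_ennreal2) (auto intro!: summable_geometric)
  finally have "AE w in M. (\<Sum>n. ennreal (exp (X n w))) \<noteq> \<infinity>"
    by (intro nn_integral_noteq_infinite) auto
  then show ?thesis
  proof eventually_elim
    case (elim w)
    then have "summable (\<lambda>n. exp (X n w))"
      by (intro summable_suminf_not_top) auto
    then have lim: "(\<lambda>n. exp (X n w)) \<longlonglongrightarrow> 0"
      by (rule summable_LIMSEQ_zero)
    show ?case
    proof
      fix b
      from order_tendstoD(2)[OF lim, of "exp b"] have "\<forall>\<^sub>F n in sequentially. X n w < b" by simp
      then show "\<exists>n0. \<forall>n\<ge>n0. X n w \<le> b"
        unfolding eventually_sequentially by (auto intro: less_imp_le)
    qed
  qed
qed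

lemma measurable_pos [measurable (raw)]:
  assumes [measurable]: "\<And>j. (\<lambda>w. g w j) \<in> borel_measurable M"
  shows "(\<lambda>w. pos (g w) n) \<in> borel_measurable M"
  unfolding pos_def by measurable

lemma measurable_departure [measurable (raw)]:
  assumes [measurable]: "\<And>j. (\<lambda>w. a w j) \<in> borel_measurable M" "\<And>j. (\<lambda>w. s w j) \<in> borel_measurable M"
  shows "(\<lambda>w. departure (a w) (s w) n) \<in> borel_measurable M"
  unfolding departure_def by measurable

lemma measurable_exit_time [measurable (raw)]:
  assumes [measurable]: "\<And>j. (\<lambda>w. g w j) \<in> borel_measurable M" "\<And>j. (\<lambda>w. s w j) \<in> borel_measurable M"
  shows "(\<lambda>w. exit_time (g w) (s w) n) \<in> borel_measurable M"
  unfolding exit_time_def by measurable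

lemma measurable_back_time [measurable (raw)]:
  assumes [measurable]: "\<And>j. (\<lambda>w. a w j) \<in> borel_measurable M" "\<And>j. (\<lambda>w. s w j) \<in> borel_measurable M"
  shows "(\<lambda>w. back_time (a w) (s w) n) \<in> borel_measurable M"
  unfolding back_time_def by measurable

section \<open>The Palm space and almost sure stability\<close>

locale stable_queue =
  fixes l m :: real
  assumes l: "0 < l" and l_less: "l < m"
begin

definition rate :: "int + int \<Rightarrow> real"
  where "rate c = (case c of Inl _ \<Rightarrow> l | Inr _ \<Rightarrow> m)"

text \<open>Gaps under \<open>Inl\<close> and services under \<open>Inr\<close> share one product,
  so that a queue step can overwrite a gap and a service in place and one resampling rule serves
  both.\<close>

definition Q :: "(int + int \<Rightarrow> real) measure"
  where "Q = PiM UNIV (\<lambda>c. expo (rate c))"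

abbreviation gap :: "(int + int \<Rightarrow> real) \<Rightarrow> int \<Rightarrow> real"
  where "gap w \<equiv> (\<lambda>j. w (Inl j))"

abbreviation serv :: "(int + int \<Rightarrow> real) \<Rightarrow> int \<Rightarrow> real"
  where "serv w \<equiv> (\<lambda>j. w (Inr j))"

lemma rate_simps [simp]: "rate (Inl j) = l" "rate (Inr j) = m"
  by (simp_all add: rate_def)

lemma rate_pos: "0 < rate c"
  using l l_less by (cases c) auto

lemma prob_space_rate: "prob_space (expo (rate c))"
  by (rule prob_space_expo) (rule rate_pos)

lemma sets_Q [measurable_cong]: "sets Q = sets (PiM UNIV (\<lambda>_. borel))"
  unfolding Q_def by (intro sets_PiM_cong) auto

lemma space_Q [simp]: "space Q = UNIV"
  by (auto simp: Q_def space_PiM)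

sublocale Q: prob_space Q
  unfolding Q_def by (intro prob_space_PiM prob_space_rate)

lemma nn_integral_Q_resample:
  assumes [measurable]: "F \<in> borel_measurable Q"
  shows "(\<integral>\<^sup>+w. F w \<partial>Q) = (\<integral>\<^sup>+w. (\<integral>\<^sup>+x. F (w(c := x)) \<partial>expo (rate c)) \<partial>Q)"
  using assms unfolding Q_def by (intro nn_integral_PiM_resample prob_space_rate)

lemma distr_Q_reindex:
  assumes "inj f" "\<And>c. rate (f c) = rate c"
  shows "distr Q Q (\<lambda>w c. w (f c)) = Q"
  using distr_PiM_reindex[of UNIV "\<lambda>c. expo (rate c)" f UNIV] assms prob_space_rate
  by (simp add: Q_def restrict_def)

lemma nn_integral_Q_exp_sum:
  assumes "finite A" "c < l" "d < m"
  shows "(\<integral>\<^sup>+w. ennreal (exp (\<Sum>j\<in>A. c * w (Inl j) + d * w (Inr j))) \<partial>Q) =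
    ennreal ((l / (l - c) * (m / (m - d))) ^ card A)"
proof -
  define f where "f i x = ennreal (exp ((case i of Inl _ \<Rightarrow> c | Inr _ \<Rightarrow> d) * x))" for i :: "int + int" and x :: real
  have [measurable]: "f i \<in> borel_measurable (expo (rate i))" for i
    unfolding f_def by measurable
  have "exp (\<Sum>j\<in>A. c * w (Inl j) + d * w (Inr j)) =
      (\<Prod>j\<in>A. exp (c * w (Inl j))) * (\<Prod>j\<in>A. exp (d * w (Inr j)))" for w
    using assms by (simp add: sum.distrib exp_add exp_sum)
  then have "ennreal (exp (\<Sum>j\<in>A. c * w (Inl j) + d * w (Inr j))) = (\<Prod>i\<in>A <+> A. f i (w i))" for w
    using assms by (simp add: prod.Plus comp_def f_def ennreal_mult' prod_nonneg prod_ennreal)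
  then have "(\<integral>\<^sup>+w. ennreal (exp (\<Sum>j\<in>A. c * w (Inl j) + d * w (Inr j))) \<partial>Q) =
      (\<Prod>i\<in>A <+> A. \<integral>\<^sup>+x. f i x \<partial>expo (rate i))"
    using assms unfolding Q_def
    by (simp only: ) (rule nn_integral_PiM_prod, auto intro: prob_space_rate)
  also have "\<dots> = (\<Prod>j\<in>A. ennreal (l / (l - c))) * (\<Prod>j\<in>A. ennreal (m / (m - d)))"
    using assms l l_less by (simp add: prod.Plus comp_def f_def nn_integral_expo_exp)
  also have "\<dots> = ennreal ((l / (l - c) * (m / (m - d))) ^ card A)"
    using assms l l_less by (simp add: ennreal_power ennreal_mult'[symmetric] flip: power_mult_distrib)
  finally show ?thesis .
qed

lemma AE_Q_stable: "AE w in Q. stable (gap w) (serv w)"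
proof -
  have "AE w in Q. \<forall>c. 0 < w c"
    unfolding AE_all_countable Q_def
    by (intro allI AE_PiM_component prob_space_rate AE_expo_pos rate_pos UNIV_I)
  moreover
  \<comment> \<open>For \<open>0 < h < m\<close> the ratio
    \<open>l / (l + h) * (m / (m - h))\<close> is below one exactly when \<open>h < m - l\<close>;
    the midpoint maximises \<open>(l + h) * (m - h)\<close>.\<close>
  define h where "h = (m - l) / 2"
  define r where "r = l / (l + h) * (m / (m - h))"
  have h: "0 < h" "h < m - l" "l < l + h" "0 < m - h" using l l_less by (auto simp: h_def field_simps)
  have "m * l < (l + h) * (m - h)"
    using mult_strict_left_mono[OF h(2,1)] by (simp add: algebra_simps)
  then have r: "0 \<le> r" "r < 1"
    using l l_less h by (simp_all add: r_def divide_less_eq_1_pos mult.commute)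
  have "AE w in Q. \<forall>b. \<exists>n0. \<forall>n\<ge>n0. (\<Sum>j\<in>{- int n..<0}. (- h) * w (Inl j) + h * w (Inr j)) \<le> b"
    using l l_less h r nn_integral_Q_exp_sum[of "{- int n..<0}" "- h" h for n]
    by (intro AE_exp_tendsto_0[where r = r]) (auto simp: r_def)
  \<comment> \<open>Chernoff with exponent \<open>-1\<close> on the gaps alone, which makes the
    arrivals unbounded to the right.\<close>
  moreover have "AE w in Q. \<forall>b. \<exists>n0. \<forall>n\<ge>n0. (\<Sum>j\<in>{0..<int n}. (- 1) * w (Inl j) + 0 * w (Inr j)) \<le> b"
    using l l_less nn_integral_Q_exp_sum[of "{0..<int n}" "- 1" 0 for n]
    by (intro AE_exp_tendsto_0[where r = "l / (l + 1)"]) auto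
  ultimately show ?thesis
  proof eventually_elim
    case (elim w)
    have "\<exists>k0. \<forall>k\<le>k0. pos (gap w) k - pos (serv w) k \<le> b" for b
    proof -
      obtain n0 where n0: "\<And>n. n \<ge> n0 \<Longrightarrow> (\<Sum>j\<in>{- int n..<0}. (- h) * w (Inl j) + h * w (Inr j)) \<le> h * b"
        using elim(2) by meson
      have "pos (gap w) k - pos (serv w) k \<le> b" if "k \<le> - int n0" for k
      proof -
        have k: "{- int (nat (- k))..<0} = {k..<0}" using that by auto
        have "pos (gap w) k = - (\<Sum>j\<in>{k..<0}. w (Inl j))" "pos (serv w) k = - (\<Sum>j\<in>{k..<0}. w (Inr j))"
          using that by (auto simp: pos_def)
        then have "(\<Sum>j\<in>{k..<0}. (- h) * w (Inl j) + h * w (Inr j)) = h * (pos (gap w) k - pos (serv w) k)"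
          by (simp add: sum.distrib sum_negf sum_subtractf sum_distrib_left[symmetric] algebra_simps)
        then show ?thesis
          using n0[of "nat (- k)"] that h unfolding k by simp
      qed
      then show ?thesis by auto
    qed
    moreover have "\<exists>k. b < pos (gap w) k" for b
    proof -
      obtain n where "(\<Sum>j\<in>{0..<int n}. (- 1) * w (Inl j) + 0 * w (Inr j)) \<le> - b - 1"
        using elim(3) by blast
      then have "b < pos (gap w) (int n)"
        by (simp add: pos_def sum_negf)
      then show ?thesis ..
    qed
    ultimately show ?case using elim(1) by (simp add: stable_def)
  qed
qed

text \<open>Here \<open>y\<close> is the sojourn time of customer \<open>n\<close> and is replaced
  by that of customer \<open>n + 1\<close>. The consumed gap \<open>n\<close> makes room for the gap
  between departures \<open>n\<close> and \<open>n + 1\<close>, and the consumed service of customer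
  \<open>n + 1\<close> for the back time of customer \<open>n\<close>.\<close>

definition step :: "int \<Rightarrow> real \<times> (int + int \<Rightarrow> real) \<Rightarrow> real \<times> (int + int \<Rightarrow> real)"
  where "step n = (\<lambda>(y, w). (max (y - w (Inl n)) 0 + w (Inr (n + 1)),
    w(Inl n := max (w (Inl n) - y) 0 + w (Inr (n + 1)), Inr (n + 1) := min y (w (Inl n)))))"

lemma measurable_upd_Q [measurable (raw)]:
  assumes "f \<in> N \<rightarrow>\<^sub>M Q" "h \<in> borel_measurable N"
  shows "(\<lambda>x. (f x)(i := h x)) \<in> N \<rightarrow>\<^sub>M Q"
  using assms measurable_fun_upd_UNIV[of f N "\<lambda>_. borel" h i]
  by (simp add: measurable_cong_sets[OF refl sets_Q])

lemma measurable_step [measurable]: "step n \<in> borel \<Otimes>\<^sub>M Q \<rightarrow>\<^sub>M borel \<Otimes>\<^sub>M Q"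
  unfolding step_def by measurable

lemma nn_integral_Q_resample2:
  assumes [measurable]: "F \<in> borel_measurable Q"
  shows "(\<integral>\<^sup>+w. F w \<partial>Q) =
    (\<integral>\<^sup>+w. (\<integral>\<^sup>+x. \<integral>\<^sup>+y. F (w(c := x, d := y)) \<partial>expo (rate d) \<partial>expo (rate c)) \<partial>Q)"
proof -
  interpret d: prob_space "expo (rate d)" by (rule prob_space_rate)
  have "(\<integral>\<^sup>+w. F w \<partial>Q) = (\<integral>\<^sup>+w. (\<integral>\<^sup>+y. F (w(d := y)) \<partial>expo (rate d)) \<partial>Q)"
    by (rule nn_integral_Q_resample) measurable
  also have "\<dots> = (\<integral>\<^sup>+w. (\<integral>\<^sup>+x. \<integral>\<^sup>+y. F (w(c := x, d := y)) \<partial>expo (rate d) \<partial>expo (rate c)) \<partial>Q)"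
    by (rule nn_integral_Q_resample) measurable
  finally show ?thesis .
qed

sublocale Y: prob_space "expo (m - l)"
  using l_less by (intro prob_space_expo) simp

sublocale YQ: pair_prob_space "expo (m - l)" Q ..

text \<open>Only \<open>y\<close>, \<open>w (Inl n)\<close> and \<open>w (Inr (n + 1))\<close>
  change. With the other coordinates frozen they are independent of parameters \<open>m - l\<close>,
  \<open>l\<close> and \<open>m\<close>, so \<open>nn_integral_expo_swap\<close> applies.\<close>

lemma nn_integral_step:
  assumes F[measurable]: "F \<in> borel_measurable (borel \<Otimes>\<^sub>M Q)"
  shows "(\<integral>\<^sup>+p. F (step n p) \<partial>(expo (m - l) \<Otimes>\<^sub>M Q)) = (\<integral>\<^sup>+p. F p \<partial>(expo (m - l) \<Otimes>\<^sub>M Q))"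
proof -
  interpret L: prob_space "expo l" using l by (rule prob_space_expo)
  interpret M: prob_space "expo m" using l l_less by (intro prob_space_expo) simp
  have resample: "(\<integral>\<^sup>+p. F p \<partial>(expo (m - l) \<Otimes>\<^sub>M Q)) =
      (\<integral>\<^sup>+w. \<integral>\<^sup>+y. \<integral>\<^sup>+g. \<integral>\<^sup>+s. F (y, w(Inl n := g, Inr (n + 1) := s)) \<partial>expo m \<partial>expo l \<partial>expo (m - l) \<partial>Q)"
    if [measurable]: "F \<in> borel_measurable (borel \<Otimes>\<^sub>M Q)" for F
  proof -
    have "(\<integral>\<^sup>+p. F p \<partial>(expo (m - l) \<Otimes>\<^sub>M Q)) = (\<integral>\<^sup>+y. \<integral>\<^sup>+w. F (y, w) \<partial>Q \<partial>expo (m - l))"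
      by (subst Q.nn_integral_fst[symmetric]) auto
    also have "\<dots> = (\<integral>\<^sup>+y. \<integral>\<^sup>+w. \<integral>\<^sup>+g. \<integral>\<^sup>+s. F (y, w(Inl n := g, Inr (n + 1) := s)) \<partial>expo m \<partial>expo l \<partial>Q \<partial>expo (m - l))"
      using nn_integral_Q_resample2[of "\<lambda>w. F (y, w)" "Inl n" "Inr (n + 1)" for y] by simp
    also have "\<dots> = (\<integral>\<^sup>+w. \<integral>\<^sup>+y. \<integral>\<^sup>+g. \<integral>\<^sup>+s. F (y, w(Inl n := g, Inr (n + 1) := s)) \<partial>expo m \<partial>expo l \<partial>expo (m - l) \<partial>Q)"
      by (rule YQ.Fubini'[symmetric]) measurable
    finally show ?thesis .
  qed
  have "(\<integral>\<^sup>+p. F (step n p) \<partial>(expo (m - l) \<Otimes>\<^sub>M Q)) =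
      (\<integral>\<^sup>+w. \<integral>\<^sup>+y. \<integral>\<^sup>+g. \<integral>\<^sup>+s. F (max (y - g) 0 + s, w(Inl n := max (g - y) 0 + s, Inr (n + 1) := min y g))
        \<partial>expo m \<partial>expo l \<partial>expo (m - l) \<partial>Q)"
    by (subst resample) (auto simp: step_def fun_upd_twist)
  also have "\<dots> = (\<integral>\<^sup>+w. \<integral>\<^sup>+y. \<integral>\<^sup>+g. \<integral>\<^sup>+s. F (y, w(Inl n := g, Inr (n + 1) := s)) \<partial>expo m \<partial>expo l \<partial>expo (m - l) \<partial>Q)"
    using nn_integral_expo_swap[OF l l_less, of "\<lambda>(y, g, s). F (y, w(Inl n := g, Inr (n + 1) := s))" for w]
    by simp
  also have "\<dots> = (\<integral>\<^sup>+p. F p \<partial>(expo (m - l) \<Otimes>\<^sub>M Q))"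
    by (rule resample[symmetric]) measurable
  finally show ?thesis .
qed

fun steps :: "int \<Rightarrow> nat \<Rightarrow> real \<times> (int + int \<Rightarrow> real) \<Rightarrow> real \<times> (int + int \<Rightarrow> real)" where
  "steps i 0 p = p"
| "steps i (Suc k) p = step (i + int k) (steps i k p)"

lemma measurable_steps [measurable]: "steps i k \<in> borel \<Otimes>\<^sub>M Q \<rightarrow>\<^sub>M borel \<Otimes>\<^sub>M Q"
  by (induction k) (simp_all add: measurable_ident_sets)

lemma nn_integral_steps:
  assumes [measurable]: "F \<in> borel_measurable (borel \<Otimes>\<^sub>M Q)"
  shows "(\<integral>\<^sup>+p. F (steps i k p) \<partial>(expo (m - l) \<Otimes>\<^sub>M Q)) = (\<integral>\<^sup>+p. F p \<partial>(expo (m - l) \<Otimes>\<^sub>M Q))"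
  using assms
proof (induction k arbitrary: F)
  case (Suc k)
  note [measurable] = Suc.prems
  have "(\<integral>\<^sup>+p. F (steps i (Suc k) p) \<partial>(expo (m - l) \<Otimes>\<^sub>M Q)) =
      (\<integral>\<^sup>+p. F (step (i + int k) p) \<partial>(expo (m - l) \<Otimes>\<^sub>M Q))"
    unfolding steps.simps by (rule Suc.IH) measurable
  also have "\<dots> = (\<integral>\<^sup>+p. F p \<partial>(expo (m - l) \<Otimes>\<^sub>M Q))"
    by (rule nn_integral_step) measurable
  finally show ?case .
qed simp

text \<open>The step with index \<open>j\<close> is the only one that reads or writes
  \<open>Inl j\<close> and \<open>Inr (j + 1)\<close>. Nothing is read after being overwritten, so
  the output is expressed through the original \<open>w\<close>.\<close>

lemma steps_eq:
  "steps i k (y, w) = (workload (gap w) (serv w) i y k,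
    \<lambda>c. case c of
      Inl j \<Rightarrow> if i \<le> j \<and> j < i + int k
        then max (w (Inl j) - workload (gap w) (serv w) i y (nat (j - i))) 0 + w (Inr (j + 1)) else w (Inl j)
    | Inr j \<Rightarrow> if i < j \<and> j \<le> i + int k
        then min (workload (gap w) (serv w) i y (nat (j - 1 - i))) (w (Inl (j - 1))) else w (Inr j))"
proof (induction k)
  case 0
  show ?case by (auto simp: fun_eq_iff split: sum.split)
next
  case (Suc k)
  show ?case
    unfolding steps.simps Suc.IH
    by (auto simp: step_def fun_eq_iff split: sum.split)
qed

text \<open>Agreement with the true sojourn time at one index \<open>n\<close> persists, because
  both sequences solve the same recursion. Every entry written from then on belongs to the true
  output.\<close>

lemma steps_eq_exit_time:
  assumes st: "stable (gap w) (serv w)" and i: "i \<le> n" "n \<le> k"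
    and eq: "workload (gap w) (serv w) i y (nat (n - i)) = exit_time (gap w) (serv w) n - pos (gap w) n"
  shows "n \<le> j \<Longrightarrow> j < k \<Longrightarrow> snd (steps i (nat (k - i)) (y, w)) (Inl j) =
      exit_time (gap w) (serv w) (j + 1) - exit_time (gap w) (serv w) j"
    and "n < j \<Longrightarrow> j \<le> k \<Longrightarrow> snd (steps i (nat (k - i)) (y, w)) (Inr j) =
      back_time (pos (gap w)) (serv w) (j - 1)"
proof -
  have wl: "workload (gap w) (serv w) i y (nat (j - i)) = exit_time (gap w) (serv w) j - pos (gap w) j"
    if "n \<le> j" for j
  proof -
    have "nat (j - i) = nat (n - i) + nat (j - n)" "i + int (nat (n - i)) = n" "n + int (nat (j - n)) = j"
      using i that by auto
    then show ?thesis
      using workload_add[of "gap w" "serv w" i y "nat (n - i)" "nat (j - n)"]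
        workload_exit_time[OF st, of n "nat (j - n)"] eq
      by simp
  qed
  show "snd (steps i (nat (k - i)) (y, w)) (Inl j) =
      exit_time (gap w) (serv w) (j + 1) - exit_time (gap w) (serv w) j" if "n \<le> j" "j < k"
    using that i exit_time_add_1[OF st, of j] pos_add_1[of "gap w" j]
    by (simp add: steps_eq wl max_def)
  show "snd (steps i (nat (k - i)) (y, w)) (Inr j) =
      back_time (pos (gap w)) (serv w) (j - 1)" if "n < j" "j \<le> k"
    using that i wl[of "j - 1"] by (simp add: steps_eq back_time_exit[OF st])
qed

lemma measurable_Q_I:
  "(\<And>c. (\<lambda>x. f x c) \<in> borel_measurable M) \<Longrightarrow> f \<in> M \<rightarrow>\<^sub>M Q"
  unfolding measurable_cong_sets[OF refl sets_Q] by (rule measurable_PiM_single') auto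

section \<open>The output process and its law\<close>

definition outflow :: "(int + int \<Rightarrow> real) \<Rightarrow> int + int \<Rightarrow> real"
  where "outflow w c = (case c of
      Inl j \<Rightarrow> exit_time (gap w) (serv w) (j + 1) - exit_time (gap w) (serv w) j
    | Inr j \<Rightarrow> back_time (pos (gap w)) (serv w) j)"

lemma outflow_simps [simp]:
  "outflow w (Inl j) = exit_time (gap w) (serv w) (j + 1) - exit_time (gap w) (serv w) j"
  "outflow w (Inr j) = back_time (pos (gap w)) (serv w) j"
  by (simp_all add: outflow_def)

lemma measurable_outflow_component: "(\<lambda>w. outflow w c) \<in> borel_measurable Q"
  unfolding outflow_def by (cases c) (simp; measurable)+

lemma measurable_outflow [measurable]: "outflow \<in> Q \<rightarrow>\<^sub>M Q"
  by (rule measurable_Q_I) (rule measurable_outflow_component)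

text \<open>
  The marks produced by \<^term>\<open>steps\<close> sit one index to the right of their customer.
\<close>

definition mark_shift :: "int + int \<Rightarrow> int + int"
  where "mark_shift = map_sum id (\<lambda>j. j - 1)"

lemma mark_shift_simps [simp]: "mark_shift (Inl j) = Inl j" "mark_shift (Inr j) = Inr (j - 1)"
  by (simp_all add: mark_shift_def)

lemma distr_pair_fst: "distr (expo (m - l) \<Otimes>\<^sub>M Q) (expo (m - l)) fst = expo (m - l)"
proof (rule measure_eqI)
  fix A assume "A \<in> sets (distr (expo (m - l) \<Otimes>\<^sub>M Q) (expo (m - l)) fst)"
  then have [measurable]: "A \<in> sets borel" by simp
  have "fst -` A \<inter> space (expo (m - l) \<Otimes>\<^sub>M Q) = A \<times> UNIV"
    by (auto simp: space_pair_measure)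
  then show "emeasure (distr (expo (m - l) \<Otimes>\<^sub>M Q) (expo (m - l)) fst) A = emeasure (expo (m - l)) A"
    using sets.top[of Q] Q.emeasure_space_1 by (simp add: emeasure_distr Q.emeasure_pair_measure_Times)
qed simp

lemma distr_pair_snd: "distr (expo (m - l) \<Otimes>\<^sub>M Q) Q snd = Q"
proof (rule measure_eqI)
  fix A assume "A \<in> sets (distr (expo (m - l) \<Otimes>\<^sub>M Q) Q snd)"
  then have [measurable]: "A \<in> sets Q" by simp
  have "snd -` A \<inter> space (expo (m - l) \<Otimes>\<^sub>M Q) = UNIV \<times> A"
    by (auto simp: space_pair_measure)
  then show "emeasure (distr (expo (m - l) \<Otimes>\<^sub>M Q) Q snd) A = emeasure Q A"
    using Y.emeasure_space_1 by (simp add: emeasure_distr Q.emeasure_pair_measure_Times)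
qed simp

lemma nn_integral_snd:
  assumes "f \<in> borel_measurable Q"
  shows "(\<integral>\<^sup>+p. f (snd p) \<partial>(expo (m - l) \<Otimes>\<^sub>M Q)) = (\<integral>\<^sup>+w. f w \<partial>Q)"
  using nn_integral_distr[OF measurable_snd, of f "expo (m - l)" Q] assms unfolding distr_pair_snd by simp

text \<open>A cylinder event of the output is evaluated along runs started at \<open>- N\<close>.
  Its probability is that of \<open>Q\<close> for every \<open>N\<close>, while its indicator
  converges almost surely to the one for the true output; dominated convergence equates the
  two.\<close>

lemma distr_Q_outflow: "distr Q Q outflow = Q"
proof -
  have 1: "distr Q Q (\<lambda>w c. outflow w (mark_shift c)) = Q"
  proof (rule measure_eqI_PiM_infinite)
    show "sets (distr Q Q (\<lambda>w c. outflow w (mark_shift c))) = sets (PiM UNIV (\<lambda>c. expo (rate c)))" "sets Q = sets (PiM UNIV (\<lambda>c. expo (rate c)))"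
      by (simp_all add: Q_def)
    have [measurable]: "(\<lambda>w c. outflow w (mark_shift c)) \<in> Q \<rightarrow>\<^sub>M Q"
      by (rule measurable_Q_I) (rule measurable_outflow_component)
    interpret D: prob_space "distr Q Q (\<lambda>w c. outflow w (mark_shift c))"
      by (rule Q.prob_space_distr) measurable
    show "finite_measure (distr Q Q (\<lambda>w c. outflow w (mark_shift c)))"
      by (rule D.finite_measure_axioms)
    fix A J assume J: "finite J" and A: "\<And>c. c \<in> J \<Longrightarrow> A c \<in> sets (expo (rate c))"
    define C where "C = prod_emb UNIV (\<lambda>c. expo (rate c)) J (Pi\<^sub>E J A)"
    have C: "w \<in> C \<longleftrightarrow> (\<forall>c\<in>J. w c \<in> A c)" for w
      by (auto simp: C_def prod_emb_def PiE_iff)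
    have [measurable]: "C \<in> sets Q"
      unfolding C_def Q_def using J A by (intro sets_PiM_I) auto
    \<comment> \<open>All indices in \<open>J\<close> lie strictly between \<open>- b\<close> and
      \<open>b\<close>: coalescence at \<open>- b\<close> and a run up to \<open>b\<close> determine
      every coordinate in question.\<close>
    define b where "b = Max (insert 0 (case_sum abs abs ` J)) + 1"
    have "case_sum abs abs c \<le> Max (insert 0 (case_sum abs abs ` J))" if "c \<in> J" for c :: "int + int"
      using J that by (intro Max_ge) auto
    from this[of "Inl _"] this[of "Inr _"]
    have b: "\<And>j. Inl j \<in> J \<Longrightarrow> \<bar>j\<bar> < b" "\<And>j. Inr j \<in> J \<Longrightarrow> \<bar>j\<bar> < b"
      by (fastforce simp: b_def)+
    have "0 \<le> Max (insert 0 (case_sum abs abs ` J))"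
      using J by (intro Max_ge) auto
    then have "0 < b" by (simp add: b_def)
    let ?f = "\<lambda>N p. indicator C (snd (steps (- int N) (nat (b - (- int N))) p)) :: ennreal"
    have lim: "(\<lambda>N. \<integral>\<^sup>+p. ?f N p \<partial>(expo (m - l) \<Otimes>\<^sub>M Q)) \<longlonglongrightarrow>
        (\<integral>\<^sup>+p. indicator C (\<lambda>c. outflow (snd p) (mark_shift c)) \<partial>(expo (m - l) \<Otimes>\<^sub>M Q))"
    proof (rule nn_integral_dominated_convergence[where w = "\<lambda>_. 1"])
      have "AE y in expo (m - l). 0 \<le> y"
        using AE_expo_pos[of "m - l"] l_less by (auto elim: eventually_mono)
      then have "AE y in distr (expo (m - l) \<Otimes>\<^sub>M Q) (expo (m - l)) fst. 0 \<le> y"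
        unfolding distr_pair_fst .
      then have "AE p in expo (m - l) \<Otimes>\<^sub>M Q. 0 \<le> fst p"
        by (rule AE_distrD[rotated]) simp
      moreover have "AE w in distr (expo (m - l) \<Otimes>\<^sub>M Q) Q snd. stable (gap w) (serv w)"
        unfolding distr_pair_snd by (rule AE_Q_stable)
      then have "AE p in expo (m - l) \<Otimes>\<^sub>M Q. stable (gap (snd p)) (serv (snd p))"
        by (rule AE_distrD[rotated]) simp
      ultimately
      show "AE p in expo (m - l) \<Otimes>\<^sub>M Q. (\<lambda>N. ?f N p) \<longlonglongrightarrow> indicator C (\<lambda>c. outflow (snd p) (mark_shift c))"
      proof eventually_elim
        case (elim p)
        obtain y w where p: "p = (y, w)" by (cases p)
        with elim have y: "0 \<le> y" and st: "stable (gap w) (serv w)" by auto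
        from workload_coalesce[OF st y, of "- b"] obtain i0 where
          i0: "\<And>i. i \<le> i0 \<Longrightarrow> i \<le> - b"
            "\<And>i. i \<le> i0 \<Longrightarrow> workload (gap w) (serv w) i y (nat (- b - i)) = exit_time (gap w) (serv w) (- b) - pos (gap w) (- b)"
          by blast
        have "?f N p = indicator C (\<lambda>c. outflow (snd p) (mark_shift c))" if "nat (- i0) \<le> N" for N
        proof -
          have i: "- int N \<le> i0" using that by simp
          have "snd (steps (- int N) (nat (b - - int N)) p) c = outflow (snd p) (mark_shift c)" if "c \<in> J" for c
            using \<open>0 < b\<close> steps_eq_exit_time[OF st i0(1)[OF i] _ i0(2)[OF i], of b] b[of "projl c"] b[of "projr c"] that
            unfolding p by (cases c) auto
          then show ?thesis by (simp add: indicator_def C)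
        qed
        then show ?case
          by (intro tendsto_eventually) (auto simp: eventually_sequentially)
      qed
    qed (auto simp: YQ.emeasure_space_1 split: split_indicator)
    have const: "(\<integral>\<^sup>+p. ?f N p \<partial>(expo (m - l) \<Otimes>\<^sub>M Q)) = emeasure Q C" for N
    proof -
      have "(\<integral>\<^sup>+p. ?f N p \<partial>(expo (m - l) \<Otimes>\<^sub>M Q)) = (\<integral>\<^sup>+p. indicator C (snd p) \<partial>(expo (m - l) \<Otimes>\<^sub>M Q))"
        by (rule nn_integral_steps) measurable
      also have "\<dots> = emeasure Q C"
        by (subst nn_integral_snd) simp_all
      finally show ?thesis .
    qed
    have rhs: "(\<integral>\<^sup>+p. indicator C (\<lambda>c. outflow (snd p) (mark_shift c)) \<partial>(expo (m - l) \<Otimes>\<^sub>M Q)) =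
        (\<integral>\<^sup>+w. indicator C (\<lambda>c. outflow w (mark_shift c)) \<partial>Q)"
      by (rule nn_integral_snd) measurable
    have "emeasure Q C = (\<integral>\<^sup>+w. indicator C (\<lambda>c. outflow w (mark_shift c)) \<partial>Q)"
      using lim unfolding const rhs by (simp only: tendsto_const_iff[OF sequentially_bot])
    also have "\<dots> = (\<integral>\<^sup>+w. indicator C w \<partial>distr Q Q (\<lambda>w c. outflow w (mark_shift c)))"
      by (subst nn_integral_distr) auto
    finally show "emeasure (distr Q Q (\<lambda>w c. outflow w (mark_shift c))) (prod_emb UNIV (\<lambda>c. expo (rate c)) J (Pi\<^sub>E J A)) =
        emeasure Q (prod_emb UNIV (\<lambda>c. expo (rate c)) J (Pi\<^sub>E J A))"
      by (simp add: C_def[symmetric])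
  qed
  \<comment> \<open>\<open>f\<close> inverts \<open>mark_shift\<close>. Relabelling the services by
    one index preserves the product law and removes the offset of the marks.\<close>
  define f :: "int + int \<Rightarrow> int + int" where "f = map_sum id (\<lambda>j. j + 1)"
  have f: "mark_shift (f c) = c" "rate (f c) = rate c" for c
    by (cases c; simp add: f_def mark_shift_def)+
  then have "inj f" by (metis injI)
  have [measurable]: "(\<lambda>w c. w (f c)) \<in> Q \<rightarrow>\<^sub>M Q"
    by (rule measurable_Q_I) measurable
  have [measurable]: "(\<lambda>w c. outflow w (mark_shift c)) \<in> Q \<rightarrow>\<^sub>M Q"
    by (rule measurable_Q_I) (rule measurable_outflow_component)
  have "distr Q Q outflow = distr (distr Q Q (\<lambda>w c. outflow w (mark_shift c))) Q (\<lambda>w c. w (f c))"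
    by (subst distr_distr) (auto simp: comp_def f)
  also have "\<dots> = Q"
    unfolding 1 using \<open>inj f\<close> f(2) by (rule distr_Q_reindex)
  finally show ?thesis .
qed

end

section \<open>Configurations and the exchange of cells\<close>

lemma space_config_space [simp]: "space config_space = UNIV"
  unfolding config_space_def by (simp add: space_measure_of_conv)

text \<open>A point hit by several indices is counted only at the first of them. This writes the
  count as a series of conditions on the \<open>Y k\<close>, from which the measurability of random
  configurations follows.\<close>

lemma num_points_range:
  fixes Y :: "nat \<Rightarrow> 'a"
  shows "num_points B (range Y) = (\<Sum>k. if Y k \<in> B \<and> (\<forall>j<k. Y j \<noteq> Y k) then 1 else 0)"
proof -
  define A where "A = {k. Y k \<in> B \<and> (\<forall>j<k. Y j \<noteq> Y k)}"
  have "inj_on Y A"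
    by (intro inj_onI) (metis (mono_tags, lifting) A_def linorder_neqE_nat mem_Collect_eq)
  moreover have "Y ` A = range Y \<inter> B"
  proof (intro equalityI subsetI)
    fix y assume "y \<in> range Y \<inter> B"
    then obtain k where k: "Y k = y" "y \<in> B" by auto
    define i where "i = (LEAST k. Y k = y)"
    have "Y i = y" unfolding i_def using k(1) by (rule LeastI)
    moreover have "Y j \<noteq> y" if "j < i" for j
      using not_less_Least[of j "\<lambda>k. Y k = y"] that unfolding i_def by simp
    ultimately show "y \<in> Y ` A" using k(2) by (auto simp: A_def image_iff)
  qed (auto simp: A_def)
  ultimately have bij: "bij_betw Y A (range Y \<inter> B)"
    by (simp add: bij_betw_def)
  have "num_points B (range Y) = (\<integral>\<^sup>+x. 1 \<partial>count_space (range Y \<inter> B))"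
    by (simp add: num_points_def emeasure_count_space)
  also have "\<dots> = (\<integral>\<^sup>+x. 1 \<partial>count_space A)"
    using nn_integral_bij_count_space[OF bij, of "\<lambda>_. 1"] by simp
  also have "\<dots> = (\<integral>\<^sup>+k. indicator A k \<partial>count_space UNIV)"
    by (simp add: emeasure_count_space)
  also have "\<dots> = (\<Sum>k. indicator A k)"
    by (rule nn_integral_count_space_nat)
  finally show ?thesis
    by (simp add: A_def indicator_def of_bool_def)
qed

lemma measurable_config:
  fixes X :: "int \<Rightarrow> 'w \<Rightarrow> 'a :: {second_countable_topology, metric_space}"
  assumes X[measurable]: "\<And>n. X n \<in> borel_measurable M"
  shows "(\<lambda>w. {X n w | n. True}) \<in> M \<rightarrow>\<^sub>M config_space"
  unfolding config_space_def
proof (rule measurable_measure_of)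
  fix U :: "'a set set" assume "U \<in> {num_points B -` S | B S. B \<in> sets borel \<and> S \<in> sets borel}"
  then obtain B :: "'a set" and S where U: "U = num_points B -` S" and [measurable]: "B \<in> sets borel" "S \<in> sets borel"
    by blast
  have range: "{X n w | n. True} = range (\<lambda>k. X (int_decode k) w)" for w
  proof -
    have "{X n w | n. True} = (\<lambda>n. X n w) ` range int_decode"
      using surj_int_decode by auto
    then show ?thesis by (simp add: image_image)
  qed
  have [measurable]: "Measurable.pred M (\<lambda>w. X i w = X j w)" for i j
  proof -
    have "Measurable.pred M (\<lambda>w. dist (X i w) (X j w) = 0)" by measurable
    then show ?thesis by simp
  qed
  have "(\<lambda>w. num_points B {X n w | n. True}) \<in> borel_measurable M"
    unfolding range num_points_range by measurable
  then have "{w \<in> space M. num_points B {X n w | n. True} \<in> S} \<in> sets M"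
    by measurable
  moreover have "(\<lambda>w. {X n w | n. True}) -` U \<inter> space M = {w \<in> space M. num_points B {X n w | n. True} \<in> S}"
    unfolding U by auto
  ultimately show "(\<lambda>w. {X n w | n. True}) -` U \<inter> space M \<in> sets M"
    by simp
qed auto

lemma measurable_config_pair:
  fixes X Y :: "int \<Rightarrow> 'w \<Rightarrow> real"
  assumes [measurable]: "\<And>n. X n \<in> borel_measurable M" "\<And>n. Y n \<in> borel_measurable M"
  shows "(\<lambda>w. {(X n w, Y n w) | n. True}) \<in> M \<rightarrow>\<^sub>M config_space"
  by (rule measurable_config[of "\<lambda>n w. (X n w, Y n w)"]) (simp add: borel_prod[symmetric])

lemma measurable_departure_config:
  assumes [measurable]: "\<And>j. (\<lambda>w. a w j) \<in> borel_measurable M" "\<And>j. (\<lambda>w. s w j) \<in> borel_measurable M"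
  shows "(\<lambda>w. departure_config (a w) (s w)) \<in> M \<rightarrow>\<^sub>M config_space"
  unfolding departure_config_def by (rule measurable_config_pair) measurable

lemma measurable_arrival_config:
  assumes [measurable]: "\<And>j. (\<lambda>w. a w j) \<in> borel_measurable M" "\<And>j. (\<lambda>w. s w j) \<in> borel_measurable M"
  shows "(\<lambda>w. arrival_config (a w) (s w)) \<in> M \<rightarrow>\<^sub>M config_space"
  unfolding arrival_config_def by (rule measurable_config_pair) measurable

section \<open>Covariance of the queue under translation and renumbering\<close>

lemma real_departure_translate:
  assumes "\<bar>departure a s n\<bar> \<noteq> \<infinity>"
  shows "real_of_ereal (departure (\<lambda>k. a k - t) s n) = real_of_ereal (departure a s n) - t"
  using assms unfolding departure_translate by (cases "departure a s n") auto

lemma back_time_translate: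
  assumes "\<bar>departure a s n\<bar> \<noteq> \<infinity>"
  shows "back_time (\<lambda>k. a k - t) s n = back_time a s n"
  using assms unfolding back_time_def departure_translate
  by (cases "departure a s n") (auto simp: min_def)

lemma back_time_reindex: "back_time (\<lambda>k. a (k + j)) (\<lambda>k. s (k + j)) n = back_time a s (n + j)"
  unfolding back_time_def departure_reindex by (simp add: add_ac)

text \<open>Moving index and origin to arrival \<open>k\<close> carries the departures along. This
  joint covariance is what makes arrival and departure cells exchangeable.\<close>

lemma exit_time_shift:
  assumes "stable g s"
  shows "exit_time (\<lambda>j. g (j + k)) (\<lambda>j. s (j + k)) n = exit_time g s (n + k) - pos g k"
    and "back_time (pos (\<lambda>j. g (j + k))) (\<lambda>j. s (j + k)) n = back_time (pos g) s (n + k)"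
proof -
  have eq: "pos (\<lambda>j. g (j + k)) = (\<lambda>n. pos g (n + k) - pos g k)"
    by (rule ext) (rule pos_shift)
  have fin: "\<bar>departure (\<lambda>n. pos g (n + k)) (\<lambda>j. s (j + k)) n\<bar> \<noteq> \<infinity>"
    unfolding departure_reindex using assms by (rule stable_departure_finite)
  show "exit_time (\<lambda>j. g (j + k)) (\<lambda>j. s (j + k)) n = exit_time g s (n + k) - pos g k"
    unfolding exit_time_def eq real_departure_translate[OF fin] by (simp add: departure_reindex)
  show "back_time (pos (\<lambda>j. g (j + k))) (\<lambda>j. s (j + k)) n = back_time (pos g) s (n + k)"
    unfolding eq back_time_translate[OF fin] by (rule back_time_reindex)
qed

lemma measurable_indicator_atLeastLessThan [measurable (raw)]:
  fixes f g h :: "'a \<Rightarrow> real"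
  assumes [measurable]: "f \<in> borel_measurable M" "g \<in> borel_measurable M" "h \<in> borel_measurable M"
  shows "(\<lambda>x. indicator {f x..<g x} (h x) :: ennreal) \<in> borel_measurable M"
  unfolding indicator_def atLeastLessThan_iff by measurable

context stable_queue begin

definition shift :: "int \<Rightarrow> (int + int \<Rightarrow> real) \<Rightarrow> int + int \<Rightarrow> real"
  where "shift k w c = w (map_sum (\<lambda>j. j + k) (\<lambda>j. j + k) c)"

lemma shift_simps [simp]: "shift k w (Inl j) = w (Inl (j + k))" "shift k w (Inr j) = w (Inr (j + k))"
  by (simp_all add: shift_def)

lemma measurable_shift [measurable]: "shift k \<in> Q \<rightarrow>\<^sub>M Q"
  unfolding shift_def[abs_def] by (rule measurable_Q_I) measurable

lemma nn_integral_shift: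
  assumes [measurable]: "F \<in> borel_measurable Q"
  shows "(\<integral>\<^sup>+w. F (shift k w) \<partial>Q) = (\<integral>\<^sup>+w. F w \<partial>Q)"
proof -
  have "distr Q Q (shift k) = Q"
    unfolding shift_def[abs_def]
  proof (rule distr_Q_reindex)
    show "inj (map_sum (\<lambda>j. j + k) (\<lambda>j. j + k))"
      by (intro sum.inj_map) (auto simp: inj_def)
    show "rate (map_sum (\<lambda>j. j + k) (\<lambda>j. j + k) c) = rate c" for c
      by (cases c) auto
  qed
  then show ?thesis
    using nn_integral_distr[of "shift k" Q Q F] by simp
qed

text \<open>
  Mass transport between the tilings of the line by arrivals and by departures: both move along
  with the index shift, so the cell at \<open>0\<close> of one may be exchanged for that of the other.
\<close>

lemma nn_integral_exchange_cells:
  assumes G[measurable]: "G \<in> borel_measurable (borel \<Otimes>\<^sub>M Q)"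
    and inv: "\<And>t w k. stable (gap w) (serv w) \<Longrightarrow> G (t - pos (gap w) k, shift k w) = G (t, w)"
  shows "(\<integral>\<^sup>+w. \<integral>\<^sup>+t. indicator {0..<w (Inl 0)} t * G (t, w) \<partial>lborel \<partial>Q) =
    (\<integral>\<^sup>+w. \<integral>\<^sup>+t. indicator {exit_time (gap w) (serv w) 0..<exit_time (gap w) (serv w) 1} t * G (t, w) \<partial>lborel \<partial>Q)"
proof -
  define a where "a n = (\<lambda>(t, w). indicator {pos (gap w) n..<pos (gap w) (n + 1)} t :: ennreal)" for n
  define d where "d n = (\<lambda>(t, w). indicator {exit_time (gap w) (serv w) n..<exit_time (gap w) (serv w) (n + 1)} t :: ennreal)" for n
  have [measurable]: "a n \<in> borel_measurable (borel \<Otimes>\<^sub>M Q)" "d n \<in> borel_measurable (borel \<Otimes>\<^sub>M Q)" for n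
    unfolding a_def d_def split_beta' by measurable
  have sum_a: "(\<integral>\<^sup>+n. a (- n) (t, w) \<partial>count_space UNIV) = 1" if "stable (gap w) (serv w)" for t w
  proof -
    have "bij (uminus :: int \<Rightarrow> int)" by (simp add: bij_uminus)
    then have "(\<integral>\<^sup>+n. a (- n) (t, w) \<partial>count_space UNIV) = (\<integral>\<^sup>+n. a n (t, w) \<partial>count_space UNIV)"
      by (rule nn_integral_bij_count_space)
    also have "\<dots> = 1"
      unfolding a_def prod.case using that pos_unbounded[OF that]
      by (intro tiling_indicator strict_mono_pos) (auto simp: stable_def)
    finally show ?thesis .
  qed
  have sum_d: "(\<integral>\<^sup>+n. d n (t, w) \<partial>count_space UNIV) = 1" if "stable (gap w) (serv w)" for t w
    unfolding d_def prod.case using that exit_time_less exit_time_unbounded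
    by (intro tiling_indicator strict_mono_int_Suc) auto
  \<comment> \<open>The index shift preserves \<open>Q\<close>, the translation preserves Lebesgue
    measure, and together they send the pair (arrival cell \<open>0\<close>, departure cell
    \<open>n\<close>) to (arrival cell \<open>- n\<close>, departure cell \<open>0\<close>). Summing
    over \<open>n\<close> erases the departure cell on the left and the arrival cell on the
    right.\<close>
  have cell: "(\<integral>\<^sup>+w. \<integral>\<^sup>+t. a 0 (t, w) * d n (t, w) * G (t, w) \<partial>lborel \<partial>Q) =
      (\<integral>\<^sup>+w. \<integral>\<^sup>+t. a (- n) (t, w) * d 0 (t, w) * G (t, w) \<partial>lborel \<partial>Q)" for n
  proof -
    have "(\<integral>\<^sup>+w. \<integral>\<^sup>+t. a 0 (t, w) * d n (t, w) * G (t, w) \<partial>lborel \<partial>Q) =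
        (\<integral>\<^sup>+w. \<integral>\<^sup>+t. a 0 (t, shift (- n) w) * d n (t, shift (- n) w) * G (t, shift (- n) w) \<partial>lborel \<partial>Q)"
      by (rule nn_integral_shift[symmetric]) measurable
    also have "\<dots> = (\<integral>\<^sup>+w. \<integral>\<^sup>+t. a (- n) (t, w) * d 0 (t, w) * G (t, w) \<partial>lborel \<partial>Q)"
    proof (rule nn_integral_cong_AE, use AE_Q_stable in eventually_elim)
      case (elim w)
      let ?c = "- pos (gap w) (- n)"
      have "(\<integral>\<^sup>+t. a 0 (t, shift (- n) w) * d n (t, shift (- n) w) * G (t, shift (- n) w) \<partial>lborel) =
         (\<integral>\<^sup>+t. a 0 (t + ?c, shift (- n) w) * d n (t + ?c, shift (- n) w) * G (t + ?c, shift (- n) w) \<partial>lborel)"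
        by (rule nn_integral_lborel_shift[symmetric]) measurable
      also have "\<dots> = (\<integral>\<^sup>+t. a (- n) (t, w) * d 0 (t, w) * G (t, w) \<partial>lborel)"
      proof (rule nn_integral_cong)
        fix t
        have "pos (gap w) (1 - n) = pos (gap w) (- n) + w (Inl (- n))"
          using pos_add_1[of "gap w" "- n"] by simp
        then have "a 0 (t + ?c, shift (- n) w) = a (- n) (t, w)"
          by (simp add: a_def indicator_def algebra_simps)
        moreover have "d n (t + ?c, shift (- n) w) = d 0 (t, w)"
          using exit_time_shift(1)[OF elim, of "- n" n] exit_time_shift(1)[OF elim, of "- n" "n + 1"]
          by (simp add: d_def indicator_def)
        moreover have "G (t + ?c, shift (- n) w) = G (t, w)"
          using inv[OF elim, of t "- n"] by simp
        ultimately show "a 0 (t + ?c, shift (- n) w) * d n (t + ?c, shift (- n) w) * G (t + ?c, shift (- n) w) =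
            a (- n) (t, w) * d 0 (t, w) * G (t, w)" by simp
      qed
      finally show ?case .
    qed
    finally show ?thesis .
  qed
  have "(\<integral>\<^sup>+w. \<integral>\<^sup>+t. indicator {0..<w (Inl 0)} t * G (t, w) \<partial>lborel \<partial>Q) =
      (\<integral>\<^sup>+w. \<integral>\<^sup>+t. \<integral>\<^sup>+n. a 0 (t, w) * d n (t, w) * G (t, w) \<partial>count_space UNIV \<partial>lborel \<partial>Q)"
  proof (rule nn_integral_cong_AE, use AE_Q_stable in eventually_elim)
    case (elim w)
    show ?case
      by (simp add: nn_integral_multc nn_integral_cmult sum_d[OF elim]) (simp add: a_def)
  qed
  also have "\<dots> = (\<integral>\<^sup>+w. \<integral>\<^sup>+n. \<integral>\<^sup>+t. a 0 (t, w) * d n (t, w) * G (t, w) \<partial>lborel \<partial>count_space UNIV \<partial>Q)"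
    by (intro nn_integral_cong nn_integral_count_space_nn_integral) auto
  also have "\<dots> = (\<integral>\<^sup>+n. \<integral>\<^sup>+w. \<integral>\<^sup>+t. a 0 (t, w) * d n (t, w) * G (t, w) \<partial>lborel \<partial>Q \<partial>count_space UNIV)"
    by (intro nn_integral_count_space_nn_integral) auto
  also have "\<dots> = (\<integral>\<^sup>+n. \<integral>\<^sup>+w. \<integral>\<^sup>+t. a (- n) (t, w) * d 0 (t, w) * G (t, w) \<partial>lborel \<partial>Q \<partial>count_space UNIV)"
    by (simp only: cell)
  also have "\<dots> = (\<integral>\<^sup>+w. \<integral>\<^sup>+n. \<integral>\<^sup>+t. a (- n) (t, w) * d 0 (t, w) * G (t, w) \<partial>lborel \<partial>count_space UNIV \<partial>Q)"
    by (intro nn_integral_count_space_nn_integral[symmetric]) auto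
  also have "\<dots> = (\<integral>\<^sup>+w. \<integral>\<^sup>+t. \<integral>\<^sup>+n. a (- n) (t, w) * d 0 (t, w) * G (t, w) \<partial>count_space UNIV \<partial>lborel \<partial>Q)"
    by (intro nn_integral_cong nn_integral_count_space_nn_integral[symmetric]) auto
  also have "\<dots> = (\<integral>\<^sup>+w. \<integral>\<^sup>+t. indicator {exit_time (gap w) (serv w) 0..<exit_time (gap w) (serv w) 1} t * G (t, w) \<partial>lborel \<partial>Q)"
  proof (rule nn_integral_cong_AE, use AE_Q_stable in eventually_elim)
    case (elim w)
    show ?case
      by (simp add: nn_integral_multc mult.assoc sum_a[OF elim]) (simp add: d_def)
  qed
  finally show ?thesis .
qed

lemma departure_config_pos_translate:
  assumes "stable g s"
  shows "departure_config (\<lambda>n. pos g n - t) s = {(exit_time g s n - t, back_time (pos g) s n) | n. True}"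
  using assms by (simp add: departure_config_def real_departure_translate back_time_translate stable_departure_finite exit_time_def)

text \<open>Seen from departure \<open>0\<close>, departures and back times are the positions and
  marks built from \<open>outflow w\<close>. After the exchange of cells the integral is therefore
  the arrival functional at \<open>outflow w\<close>, and \<open>distr_Q_outflow\<close> removes
  \<open>outflow\<close>.\<close>

lemma departure_config_eq_arrival_config_palm:
  assumes C[measurable]: "C \<in> sets config_space"
  shows "(\<integral>\<^sup>+w. \<integral>\<^sup>+t. indicator {0..<w (Inl 0)} t * indicator C (departure_config (\<lambda>n. pos (gap w) n - t) (serv w)) \<partial>lborel \<partial>Q) =
    (\<integral>\<^sup>+w. \<integral>\<^sup>+t. indicator {0..<w (Inl 0)} t * indicator C (arrival_config (\<lambda>n. pos (gap w) n - t) (serv w)) \<partial>lborel \<partial>Q)"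
proof -
  \<comment> \<open>Real-valued form of the departure configuration. The two are identified on
    stable paths, hence almost surely.\<close>
  define D where "D = (\<lambda>(t, w). {(exit_time (gap w) (serv w) n - t, back_time (pos (gap w)) (serv w) n) | n. True})"
  have [measurable]: "D \<in> borel \<Otimes>\<^sub>M Q \<rightarrow>\<^sub>M config_space"
    unfolding D_def split_beta' by (rule measurable_config_pair) measurable
  define K where "K = (\<lambda>w. \<integral>\<^sup>+t. indicator {0..<w (Inl 0)} t * indicator C (arrival_config (\<lambda>n. pos (gap w) n - t) (serv w)) \<partial>lborel)"
  have "(\<lambda>p. arrival_config (\<lambda>n. pos (gap (fst p)) n - snd p) (serv (fst p))) \<in> Q \<Otimes>\<^sub>M borel \<rightarrow>\<^sub>M config_space"
    by (rule measurable_arrival_config) measurable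
  then have [measurable]: "K \<in> borel_measurable Q"
    unfolding K_def by measurable
  have "(\<integral>\<^sup>+w. \<integral>\<^sup>+t. indicator {0..<w (Inl 0)} t * indicator C (departure_config (\<lambda>n. pos (gap w) n - t) (serv w)) \<partial>lborel \<partial>Q) =
    (\<integral>\<^sup>+w. \<integral>\<^sup>+t. indicator {0..<w (Inl 0)} t * indicator C (D (t, w)) \<partial>lborel \<partial>Q)"
    by (rule nn_integral_cong_AE, use AE_Q_stable in eventually_elim)
      (simp add: departure_config_pos_translate D_def)
  also have "\<dots> = (\<integral>\<^sup>+w. \<integral>\<^sup>+t. indicator {exit_time (gap w) (serv w) 0..<exit_time (gap w) (serv w) 1} t *
      indicator C (D (t, w)) \<partial>lborel \<partial>Q)"
  proof (rule nn_integral_exchange_cells[where G = "\<lambda>p. indicator C (D p)"])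
    fix t w k assume st: "stable (gap w) (serv w)"
    have "D (t - pos (gap w) k, shift k w) =
        {(exit_time (gap w) (serv w) (n + k) - t, back_time (pos (gap w)) (serv w) (n + k)) | n. True}"
      by (simp add: D_def exit_time_shift[OF st])
    also have "\<dots> = D (t, w)"
      unfolding D_def by (auto intro: exI[of _ "_ - k"])
    finally show "(indicator C (D (t - pos (gap w) k, shift k w)) :: ennreal) = indicator C (D (t, w))"
      by simp
  qed measurable
  also have "\<dots> = (\<integral>\<^sup>+w. K (outflow w) \<partial>Q)"
  proof (rule nn_integral_cong)
    fix w :: "int + int \<Rightarrow> real"
    let ?e = "exit_time (gap w) (serv w)"
    \<comment> \<open>The output gaps telescope to departure times relative to departure
      \<open>0\<close>, so translating \<open>t\<close> by \<open>?e 0\<close> matches the two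
      pictures.\<close>
    have pos: "pos (\<lambda>j. ?e (j + 1) - ?e j) n = ?e n - ?e 0" for n
      by (rule pos_unique[symmetric]) auto
    have [measurable]: "(\<lambda>t. D (t, w)) \<in> borel \<rightarrow>\<^sub>M config_space"
      by measurable
    have "(\<integral>\<^sup>+t. indicator {?e 0..<?e 1} t * indicator C (D (t, w)) \<partial>lborel) =
        (\<integral>\<^sup>+t. indicator {?e 0..<?e 1} (t + ?e 0) * indicator C (D (t + ?e 0, w)) \<partial>lborel)"
      by (rule nn_integral_lborel_shift[symmetric]) measurable
    also have "\<dots> = K (outflow w)"
      unfolding K_def
      by (intro nn_integral_cong arg_cong2[where f = "(*)"])
        (auto simp: pos D_def arrival_config_def indicator_def algebra_simps)
    finally show "(\<integral>\<^sup>+t. indicator {?e 0..<?e 1} t * indicator C (D (t, w)) \<partial>lborel) = K (outflow w)" .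
  qed
  also have "\<dots> = (\<integral>\<^sup>+w. K w \<partial>distr Q Q outflow)"
    by (rule nn_integral_distr[symmetric]) measurable
  finally show ?thesis
    unfolding distr_Q_outflow K_def .
qed

end

section \<open>The law of the Poisson arrivals\<close>

text \<open>Equality is allowed at index \<open>0\<close> because the Palm inversion draws the
  origin from a half-open cell and may hit its left end.\<close>

definition numbered :: "(int \<Rightarrow> real) set"
  where "numbered = {a. strict_mono a \<and> a 0 \<le> 0 \<and> 0 < a 1}"

text \<open>When \<open>e k \<le> f k\<close>, the interval between them lies in the gap number
  \<open>k - k0\<close>; the offset lets natural indices reach negative points. Such events
  translate into counts \<open>0\<close> and \<open>1\<close> and are closed under
  intersection.\<close>

definition gap_box :: "nat \<Rightarrow> nat \<Rightarrow> (nat \<Rightarrow> real) \<Rightarrow> (nat \<Rightarrow> real) \<Rightarrow> (int \<Rightarrow> real) set"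
  where "gap_box k0 n e f = {a. \<forall>k\<le>n. a (int k - int k0) \<le> e k \<and> f k < a (int k - int k0 + 1)}"

text \<open>The conditions at \<open>k0\<close> put the origin into the interval of gap
  \<open>0\<close>. This anchors the numbering, which counts alone do not see.\<close>

definition admissible :: "nat \<Rightarrow> nat \<Rightarrow> (nat \<Rightarrow> real) \<Rightarrow> (nat \<Rightarrow> real) \<Rightarrow> bool"
  where "admissible k0 n e f \<longleftrightarrow> k0 \<le> n \<and> (\<forall>k\<le>n. e k \<le> f k) \<and> e k0 \<le> 0 \<and> 0 \<le> f k0"

lemma gap_box_Int:
  "gap_box k0 n e f \<inter> gap_box k0 n e' f' = gap_box k0 n (\<lambda>k. min (e k) (e' k)) (\<lambda>k. max (f k) (f' k))"
  by (auto simp: gap_box_def)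

lemma admissible_Int:
  "admissible k0 n e f \<Longrightarrow> admissible k0 n e' f' \<Longrightarrow>
    admissible k0 n (\<lambda>k. min (e k) (e' k)) (\<lambda>k. max (f k) (f' k))"
  by (auto simp: admissible_def min_def max_def)

lemma sets_gap_box [measurable]: "gap_box k0 n e f \<in> sets (PiM UNIV (\<lambda>_. borel))"
proof -
  have "{a \<in> space (PiM UNIV (\<lambda>_. borel)). \<forall>k\<le>n. a (int k - int k0) \<le> e k \<and> f k < a (int k - int k0 + 1)}
      \<in> sets (PiM UNIV (\<lambda>_. borel))"
    by measurable
  then show ?thesis by (simp add: gap_box_def space_PiM)
qed

lemma sets_numbered [measurable]: "numbered \<in> sets (PiM UNIV (\<lambda>_. borel))"
proof -
  have "{a \<in> space (PiM UNIV (\<lambda>_. borel)). (\<forall>i j. i < j \<longrightarrow> a i < a j) \<and> a 0 \<le> 0 \<and> 0 < a 1}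
      \<in> sets (PiM UNIV (\<lambda>_::int. borel :: real measure))"
    by measurable
  then show ?thesis by (simp add: numbered_def strict_mono_def space_PiM)
qed

text \<open>Presents the event that a coordinate is below \<open>c\<close> as a countable union of
  boxes. Each gap has room for a rational, and away from \<open>k0\<close> a degenerate interval
  with \<open>e k = f k\<close> suffices.\<close>

lemma ex_gap_box:
  assumes a: "a \<in> numbered" and c: "a (int i - int k0) < c" and "i \<le> n" "k0 \<le> n"
  shows "\<exists>e f. e \<in> {..n} \<rightarrow>\<^sub>E \<rat> \<and> f \<in> {..n} \<rightarrow>\<^sub>E \<rat> \<and> admissible k0 n e f \<and> e i < c \<and> a \<in> gap_box k0 n e f"
proof -
  have mono: "a (int k - int k0) < a (int k - int k0 + 1)" for k
    using a by (auto simp: numbered_def strict_mono_def)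
  have "\<exists>p. fst p \<in> \<rat> \<and> snd p \<in> \<rat> \<and> fst p \<le> snd p \<and> a (int k - int k0) \<le> fst p \<and>
      snd p < a (int k - int k0 + 1) \<and> (k = i \<longrightarrow> fst p < c) \<and> (k = k0 \<longrightarrow> fst p \<le> 0 \<and> 0 \<le> snd p)" for k
  proof (cases "k = k0")
    \<comment> \<open>This interval must contain the origin: it ends at \<open>0\<close> and starts
      at a nonpositive rational, which can only be \<open>0\<close> if
      \<open>a 0 = 0\<close>.\<close>
    case True
    define d where "d = (if k = i then c else 1)"
    have "a 0 \<le> 0" "0 < a 1" "a 0 < d"
      using a c True by (auto simp: d_def numbered_def)
    have "\<exists>q\<in>\<rat>. a 0 \<le> q \<and> q \<le> 0 \<and> q < d"
    proof (cases "a 0 = 0")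
      case True
      then show ?thesis using \<open>a 0 < d\<close> by (intro bexI[of _ 0]) auto
    next
      case False
      then have "a 0 < min 0 d" using \<open>a 0 \<le> 0\<close> \<open>a 0 < d\<close> by simp
      from Rats_dense_in_real[OF this] obtain q where "q \<in> \<rat>" "a 0 < q" "q < min 0 d" by blast
      then show ?thesis by (intro bexI[of _ q]) auto
    qed
    then obtain q where "q \<in> \<rat>" "a 0 \<le> q" "q \<le> 0" "q < d" by blast
    then show ?thesis
      using True \<open>0 < a 1\<close> by (intro exI[of _ "(q, 0)"]) (auto simp: d_def)
  next
    case False
    define d where "d = (if k = i then c else a (int k - int k0 + 1))"
    have "a (int k - int k0) < min d (a (int k - int k0 + 1))"
      using mono[of k] c by (auto simp: d_def)
    from Rats_dense_in_real[OF this] obtain q where "q \<in> \<rat>" "a (int k - int k0) < q" "q < d" "q < a (int k - int k0 + 1)"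
      by auto
    then show ?thesis
      using False by (intro exI[of _ "(q, q)"]) (auto simp: d_def)
  qed
  then obtain p where p: "\<And>k. fst (p k) \<in> \<rat> \<and> snd (p k) \<in> \<rat> \<and> fst (p k) \<le> snd (p k) \<and> a (int k - int k0) \<le> fst (p k) \<and>
      snd (p k) < a (int k - int k0 + 1) \<and> (k = i \<longrightarrow> fst (p k) < c) \<and> (k = k0 \<longrightarrow> fst (p k) \<le> 0 \<and> 0 \<le> snd (p k))"
    by metis
  then show ?thesis
    using assms(3,4)
    by (intro exI[of _ "\<lambda>k\<in>{..n}. fst (p k)"] exI[of _ "\<lambda>k\<in>{..n}. snd (p k)"])
      (auto simp: admissible_def gap_box_def)
qed

text \<open>
  The gap boxes form a pi-system which generates, on \<^term>\<open>numbered\<close>, the coordinates that they constrain.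
\<close>

lemma measure_eq_on_numbered:
  fixes M N :: "(int \<Rightarrow> real) measure"
  assumes "prob_space M" "prob_space N"
    and sets: "sets M = sets (PiM UNIV (\<lambda>_. borel))" "sets N = sets (PiM UNIV (\<lambda>_. borel))"
    and AE: "AE a in M. a \<in> numbered" "AE a in N. a \<in> numbered"
    and box: "\<And>k0 n e f. admissible k0 n e f \<Longrightarrow> emeasure M (gap_box k0 n e f) = emeasure N (gap_box k0 n e f)"
  shows "M = N"
proof (rule measure_eqI_PiM_infinite[OF sets])
  interpret M: prob_space M by fact
  interpret N: prob_space N by fact
  show "finite_measure M" by (rule M.finite_measure_axioms)
  note [measurable_cong] = sets
  have sp: "space M = UNIV" "space N = UNIV"
    using sets_eq_imp_space_eq[OF sets(1)] sets_eq_imp_space_eq[OF sets(2)] by (auto simp: space_PiM)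
  have M_int: "emeasure M (A \<inter> numbered) = emeasure M A" if "A \<in> sets M" for A
    using that AE(1) by (intro emeasure_eq_AE) auto
  have N_int: "emeasure N (A \<inter> numbered) = emeasure N A" if "A \<in> sets N" for A
    using that AE(2) by (intro emeasure_eq_AE) auto
  fix A :: "int \<Rightarrow> real set" and J :: "int set"
  assume J: "finite J" and A: "\<And>i. i \<in> J \<Longrightarrow> A i \<in> sets borel"
  \<comment> \<open>With \<open>n = 2 * k0\<close> the indices \<open>k \<le> n\<close> stand for
    the integers from \<open>- k0\<close> to \<open>k0\<close>, which cover
    \<open>J\<close>.\<close>
  define k0 where "k0 = nat (Max (insert 0 (abs ` J)))"
  have k0: "\<bar>j\<bar> \<le> int k0" if "j \<in> J" for j
  proof -
    have "\<bar>j\<bar> \<le> Max (insert 0 (abs ` J))" using that J by (intro Max_ge) auto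
    then show ?thesis by (simp add: k0_def) linarith
  qed
  define n where "n = 2 * k0"
  define G where "G = {gap_box k0 n e f \<inter> numbered | e f. admissible k0 n e f}"
  have G_Pow: "G \<subseteq> Pow numbered" by (auto simp: G_def)
  have G_sets: "G \<subseteq> sets M" "G \<subseteq> sets N" by (auto simp: G_def)
  have sub: "sigma_sets numbered G \<subseteq> sets M" "sigma_sets numbered G \<subseteq> sets N"
    using sets.sigma_sets_subset'[of G M numbered] sets.sigma_sets_subset'[of G N numbered] G_sets by auto
  have "Int_stable G"
  proof (rule Int_stableI)
    fix a b assume "a \<in> G" "b \<in> G"
    then obtain e f e' f' where "a = gap_box k0 n e f \<inter> numbered" "b = gap_box k0 n e' f' \<inter> numbered"
      "admissible k0 n e f" "admissible k0 n e' f'"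
      by (auto simp: G_def)
    then have "a \<inter> b = gap_box k0 n (\<lambda>k. min (e k) (e' k)) (\<lambda>k. max (f k) (f' k)) \<inter> numbered"
      and "admissible k0 n (\<lambda>k. min (e k) (e' k)) (\<lambda>k. max (f k) (f' k))"
      by (auto simp: gap_box_Int[symmetric] intro: admissible_Int)
    then show "a \<inter> b \<in> G"
      unfolding G_def by blast
  qed
  have eq: "emeasure M X = emeasure N X" if "X \<in> sigma_sets numbered G" for X
    using \<open>Int_stable G\<close> G_Pow that
  proof (induction rule: sigma_sets_induct_disjoint)
    case (basic X)
    then show ?case by (auto simp: G_def M_int N_int box)
  next
    case empty show ?case by simp
  next
    case (compl X)
    have "emeasure M numbered = 1" "emeasure N numbered = 1"
      using M_int[of UNIV] N_int[of UNIV] sp M.emeasure_space_1 N.emeasure_space_1 sets.top[of M] sets.top[of N] by auto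
    moreover have "X \<subseteq> numbered" using sigma_sets_into_sp[OF G_Pow compl(1)] .
    ultimately show ?case
      using compl sub by (subst (1 2) emeasure_Diff) auto
  next
    case (union X)
    then show ?case
      using sub by (subst (1 2) suminf_emeasure[symmetric]) auto
  qed
  \<comment> \<open>Both measures agree on the sets of \<open>S\<close> by \<open>eq\<close>; it
    remains to find the cylinder events over \<open>J\<close> among them.\<close>
  define S where "S = sigma numbered G"
  have space_S: "space S = numbered" and sets_S: "sets S = sigma_sets numbered G"
    using G_Pow by (auto simp: S_def space_measure_of_conv)
  have coord: "(\<lambda>a. a j) \<in> borel_measurable S" if "j \<in> J" for j
  proof (rule borel_measurableI_less)
    fix c :: real
    define i where "i = nat (j + int k0)"
    have j: "j = int i - int k0" "i \<le> n" "k0 \<le> n"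
      using k0[OF that] by (auto simp: i_def n_def)
    define T where "T = {(e, f). e \<in> {..n} \<rightarrow>\<^sub>E \<rat> \<and> f \<in> {..n} \<rightarrow>\<^sub>E \<rat> \<and> admissible k0 n e f \<and> e i < c}"
    have "countable T"
    proof (rule countable_subset)
      show "T \<subseteq> ({..n} \<rightarrow>\<^sub>E \<rat>) \<times> ({..n} \<rightarrow>\<^sub>E \<rat>)" by (auto simp: T_def)
      show "countable (({..n} \<rightarrow>\<^sub>E \<rat>) \<times> ({..n} \<rightarrow>\<^sub>E \<rat>) :: ((nat \<Rightarrow> real) \<times> (nat \<Rightarrow> real)) set)"
        by (intro countable_SIGMA countable_PiE countable_rat) auto
    qed
    have "{a \<in> space S. a j < c} = (\<Union>(e, f)\<in>T. gap_box k0 n e f \<inter> numbered)"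
    proof (intro equalityI subsetI)
      fix a assume "a \<in> {a \<in> space S. a j < c}"
      then show "a \<in> (\<Union>(e, f)\<in>T. gap_box k0 n e f \<inter> numbered)"
        using ex_gap_box[of a i k0 c n] j by (force simp: space_S T_def)
    next
      fix a assume "a \<in> (\<Union>(e, f)\<in>T. gap_box k0 n e f \<inter> numbered)"
      then show "a \<in> {a \<in> space S. a j < c}"
        using j by (force simp: space_S T_def gap_box_def)
    qed
    also have "\<dots> \<in> sets S"
      unfolding sets_S using \<open>countable T\<close>
      by (intro sigma_sets_UNION) (auto simp: T_def G_def intro!: sigma_sets.Basic)
    finally show "{a \<in> space S. a j < c} \<in> sets S" .
  qed
  have C: "prod_emb UNIV (\<lambda>_. borel) J (Pi\<^sub>E J A) \<inter> numbered = {a \<in> space S. \<forall>j\<in>J. a j \<in> A j}"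
    by (auto simp: prod_emb_def PiE_iff space_S)
  have "{a \<in> space S. a j \<in> A j} \<in> sets S" if "j \<in> J" for j
    using measurable_sets[OF coord[OF that] A[OF that]] by (simp add: vimage_def Int_def conj_commute)
  then have "{a \<in> space S. \<forall>j\<in>J. a j \<in> A j} \<in> sets S"
    using J by (intro sets.sets_Collect_finite_All) auto
  then have "emeasure M (prod_emb UNIV (\<lambda>_. borel) J (Pi\<^sub>E J A) \<inter> numbered) =
      emeasure N (prod_emb UNIV (\<lambda>_. borel) J (Pi\<^sub>E J A) \<inter> numbered)"
    unfolding C sets_S by (rule eq)
  moreover have "prod_emb UNIV (\<lambda>_. borel) J (Pi\<^sub>E J A) \<in> sets (PiM UNIV (\<lambda>_. borel))"
    using J A by (intro sets_PiM_I) auto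
  ultimately show "emeasure M (prod_emb UNIV (\<lambda>_. borel) J (Pi\<^sub>E J A)) = emeasure N (prod_emb UNIV (\<lambda>_. borel) J (Pi\<^sub>E J A))"
    by (simp only: M_int N_int sets)
qed

lemma measurable_PiM_borel_I:
  "(\<And>i. (\<lambda>x. f x i) \<in> borel_measurable N) \<Longrightarrow> f \<in> N \<rightarrow>\<^sub>M PiM UNIV (\<lambda>_. borel)"
  by (rule measurable_PiM_single') auto

text \<open>Poisson probability of no point between \<open>e k\<close> and \<open>f k\<close> and
  exactly one between \<open>f k\<close> and \<open>e (Suc k)\<close>. The exponential factors of
  all these intervals combine into one; each single point contributes rate times length.\<close>

definition box_prob :: "real \<Rightarrow> nat \<Rightarrow> (nat \<Rightarrow> real) \<Rightarrow> (nat \<Rightarrow> real) \<Rightarrow> real"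
  where "box_prob l n e f = exp (- (l * (f n - e 0))) * (\<Prod>k<n. l * (e (Suc k) - f k))"

lemma gap_box_empty:
  assumes "k < n" "e (Suc k) < f k"
  shows "gap_box k0 n e f = {}"
proof -
  have "a \<notin> gap_box k0 n e f" for a
  proof
    assume "a \<in> gap_box k0 n e f"
    then have "a (int (Suc k) - int k0) \<le> e (Suc k)" "f k < a (int k - int k0 + 1)"
      using assms(1) unfolding gap_box_def by (blast intro: Suc_leI less_imp_le)+
    moreover have "int (Suc k) - int k0 = int k - int k0 + 1" by simp
    ultimately show False using assms(2) by (metis less_trans not_less)
  qed
  then show ?thesis by blast
qed

text \<open>Positions relative to the leftmost constrained point, so that the gap to be integrated
  out next is always the last summand.\<close>

definition psum :: "nat \<Rightarrow> (int \<Rightarrow> real) \<Rightarrow> nat \<Rightarrow> real"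
  where "psum k0 g k = (\<Sum>j<k. g (int j - int k0))"

lemma psum_simps [simp]: "psum k0 g 0 = 0" "psum k0 g (Suc k) = psum k0 g k + g (int k - int k0)"
  by (simp_all add: psum_def)

lemma psum_upd [simp]: "k \<le> n \<Longrightarrow> psum k0 (g(int n - int k0 := x)) k = psum k0 g k"
  by (simp add: psum_def)

lemma pos_psum: "pos g (int k - int k0) = pos g (- int k0) + psum k0 g k"
proof (induction k)
  case (Suc k)
  then show ?case using pos_add_1[of g "int k - int k0"] by (simp add: algebra_simps)
qed simp

lemma measurable_psum [measurable (raw)]:
  assumes [measurable]: "\<And>j. (\<lambda>w. g w j) \<in> borel_measurable M"
  shows "(\<lambda>w. psum k0 (g w) n) \<in> borel_measurable M"
  unfolding psum_def by measurable

text \<open>The weight is what the tail of the gap after the last constrained point leaves behind.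
  Integrating the last gap against it cancels the exponential density, yields
  \<open>l * (e (Suc n) - f n)\<close>, and returns the same weight one point earlier.\<close>

lemma nn_integral_psum_box:
  assumes l: "0 < l" and ef: "\<And>k. k \<le> n \<Longrightarrow> e k \<le> f k" and fe: "\<And>k. k < n \<Longrightarrow> f k \<le> e (Suc k)"
  shows "(\<integral>\<^sup>+g. (if (\<forall>k<n. z + psum k0 g k \<le> e k \<and> f k < z + psum k0 g (Suc k)) \<and> z + psum k0 g n \<le> e n
      then ennreal (exp (l * (z + psum k0 g n))) else 0) \<partial>PiM UNIV (\<lambda>_. expo l)) =
    ennreal (\<Prod>k<n. l * (e (Suc k) - f k)) * (indicator {..e 0} z * ennreal (exp (l * z)))"
  using ef fe
proof (induction n)
  case 0
  interpret prob_space "PiM UNIV (\<lambda>_::int. expo l)"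
    using l by (intro prob_space_PiM prob_space_expo)
  show ?case using emeasure_space_1 by (simp add: indicator_def)
next
  case (Suc n)
  let ?G = "PiM UNIV (\<lambda>_::int. expo l)"
  let ?P = "\<lambda>g. (\<forall>k<n. z + psum k0 g k \<le> e k \<and> f k < z + psum k0 g (Suc k)) \<and> z + psum k0 g n \<le> e n"
  have "(\<integral>\<^sup>+g. (if (\<forall>k<Suc n. z + psum k0 g k \<le> e k \<and> f k < z + psum k0 g (Suc k)) \<and> z + psum k0 g (Suc n) \<le> e (Suc n)
      then ennreal (exp (l * (z + psum k0 g (Suc n)))) else 0) \<partial>?G) =
    (\<integral>\<^sup>+g. \<integral>\<^sup>+x. (if ?P g then ennreal (exp (l * (z + psum k0 g n))) *
        (indicator {f n - (z + psum k0 g n)<..e (Suc n) - (z + psum k0 g n)} x * ennreal (exp (l * x))) else 0) \<partial>expo l \<partial>?G)"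
    (is "?L = _")
  proof (subst nn_integral_PiM_resample[where k = "int n - int k0"])
    show "prob_space (expo l)" using l by (rule prob_space_expo)
    let ?g' = "\<lambda>g x. g(int n - int k0 := x)"
    have P: "(\<forall>k<Suc n. z + psum k0 (?g' g x) k \<le> e k \<and> f k < z + psum k0 (?g' g x) (Suc k)) \<longleftrightarrow>
      ?P g \<and> f n < z + psum k0 g n + x" for g x
      by (auto simp: less_Suc_eq)
    show "(\<integral>\<^sup>+g. \<integral>\<^sup>+x. (if (\<forall>k<Suc n. z + psum k0 (?g' g x) k \<le> e k \<and> f k < z + psum k0 (?g' g x) (Suc k)) \<and>
          z + psum k0 (?g' g x) (Suc n) \<le> e (Suc n)
        then ennreal (exp (l * (z + psum k0 (?g' g x) (Suc n)))) else 0) \<partial>expo l \<partial>?G) =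
      (\<integral>\<^sup>+g. \<integral>\<^sup>+x. (if ?P g then ennreal (exp (l * (z + psum k0 g n))) *
        (indicator {f n - (z + psum k0 g n)<..e (Suc n) - (z + psum k0 g n)} x * ennreal (exp (l * x))) else 0) \<partial>expo l \<partial>?G)"
      unfolding P
      by (intro nn_integral_cong)
        (auto simp: indicator_def ennreal_mult'[symmetric] exp_add[symmetric] algebra_simps)
  qed measurable
  also have "\<dots> = (\<integral>\<^sup>+g. ennreal (l * (e (Suc n) - f n)) * (if ?P g then ennreal (exp (l * (z + psum k0 g n))) else 0) \<partial>?G)"
  proof (intro nn_integral_cong)
    fix g
    have *: "(\<integral>\<^sup>+x. indicator {f n - (z + psum k0 g n)<..e (Suc n) - (z + psum k0 g n)} x * ennreal (exp (l * x)) \<partial>expo l) =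
       ennreal (l * (e (Suc n) - f n))" if "?P g"
      using that Suc.prems(1)[of n] Suc.prems(2)[of n] l
      by (subst nn_integral_expo_exp_box) (auto simp: algebra_simps)
    show "(\<integral>\<^sup>+x. (if ?P g then ennreal (exp (l * (z + psum k0 g n))) *
        (indicator {f n - (z + psum k0 g n)<..e (Suc n) - (z + psum k0 g n)} x * ennreal (exp (l * x))) else 0) \<partial>expo l) =
      ennreal (l * (e (Suc n) - f n)) * (if ?P g then ennreal (exp (l * (z + psum k0 g n))) else 0)"
    proof (cases "?P g")
      case True
      then show ?thesis
        unfolding if_P[OF True] using * by (simp add: nn_integral_cmult mult.commute)
    next
      case False
      show ?thesis unfolding if_not_P[OF False] by simp
    qed
  qed
  also have "\<dots> = ennreal (l * (e (Suc n) - f n)) * (ennreal (\<Prod>k<n. l * (e (Suc k) - f k)) * (indicator {..e 0} z * ennreal (exp (l * z))))"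
    using Suc.prems by (subst Suc.IH[symmetric]) (auto intro!: nn_integral_cmult)
  also have "\<dots> = ennreal (\<Prod>k<Suc n. l * (e (Suc k) - f k)) * (indicator {..e 0} z * ennreal (exp (l * z)))"
  proof -
    have "0 \<le> l * (e (Suc n) - f n)"
      using Suc.prems(2)[of n] l by simp
    then show ?thesis
      unfolding prod.lessThan_Suc by (subst ennreal_mult'') (simp_all only: mult_ac)
  qed
  finally show ?case .
qed

text \<open>Here \<open>z\<close> is the position of point \<open>- k0\<close>. The final gap only
  has to reach beyond \<open>f n\<close>, and its exponential tail splits into
  \<open>exp (- (l * f n))\<close> and the weight of \<open>nn_integral_psum_box\<close>.\<close>

lemma nn_integral_gap_box:
  assumes l: "0 < l" and ef: "\<And>k. k \<le> n \<Longrightarrow> e k \<le> f k" and fe: "\<And>k. k < n \<Longrightarrow> f k \<le> e (Suc k)"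
  shows "(\<integral>\<^sup>+g. indicator (gap_box k0 n e f) (\<lambda>i. z + (pos g i - pos g (- int k0))) \<partial>PiM UNIV (\<lambda>_. expo l)) =
    ennreal (exp (- (l * f n))) * (ennreal (\<Prod>k<n. l * (e (Suc k) - f k)) * (indicator {..e 0} z * ennreal (exp (l * z))))"
proof -
  let ?G = "PiM UNIV (\<lambda>_::int. expo l)"
  let ?P = "\<lambda>g. (\<forall>k<n. z + psum k0 g k \<le> e k \<and> f k < z + psum k0 g (Suc k)) \<and> z + psum k0 g n \<le> e n"
  have box: "indicator (gap_box k0 n e f) (\<lambda>i. z + (pos g i - pos g (- int k0))) =
    (if ?P g \<and> f n < z + psum k0 g (Suc n) then 1 else 0 :: ennreal)" for g
  proof -
    have "pos g (int k - int k0 + 1) = pos g (- int k0) + psum k0 g (Suc k)" for k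
      using pos_psum[of g "Suc k" k0] by (simp add: algebra_simps)
    then show ?thesis
      by (simp add: gap_box_def indicator_def pos_psum del: psum_simps) (auto simp: le_less)
  qed
  have "(\<integral>\<^sup>+g. indicator (gap_box k0 n e f) (\<lambda>i. z + (pos g i - pos g (- int k0))) \<partial>?G) =
    (\<integral>\<^sup>+g. \<integral>\<^sup>+x. (if ?P g then indicator {f n - (z + psum k0 g n)<..} x else 0) \<partial>expo l \<partial>?G)"
    unfolding box
  proof (subst nn_integral_PiM_resample[where k = "int n - int k0"])
    show "prob_space (expo l)" using l by (rule prob_space_expo)
    let ?g' = "\<lambda>g x. g(int n - int k0 := x)"
    have P: "?P (?g' g x) \<longleftrightarrow> ?P g" for g x
      by (auto simp del: psum_simps)
    show "(\<integral>\<^sup>+g. \<integral>\<^sup>+x. (if ?P (?g' g x) \<and> f n < z + psum k0 (?g' g x) (Suc n) then 1 else 0) \<partial>expo l \<partial>?G) =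
      (\<integral>\<^sup>+g. \<integral>\<^sup>+x. (if ?P g then indicator {f n - (z + psum k0 g n)<..} x else 0) \<partial>expo l \<partial>?G)"
      unfolding P by (intro nn_integral_cong) (auto simp: indicator_def algebra_simps)
  qed measurable
  also have "\<dots> = (\<integral>\<^sup>+g. ennreal (exp (- (l * f n))) * (if ?P g then ennreal (exp (l * (z + psum k0 g n))) else 0) \<partial>?G)"
  proof (intro nn_integral_cong)
    fix g
    have *: "emeasure (expo l) {f n - (z + psum k0 g n)<..} = ennreal (exp (- (l * f n))) * ennreal (exp (l * (z + psum k0 g n)))" if "?P g"
      using that ef[of n] l
      by (subst emeasure_expo_greaterThan) (auto simp: algebra_simps ennreal_mult'[symmetric] exp_add[symmetric])
    show "(\<integral>\<^sup>+x. (if ?P g then indicator {f n - (z + psum k0 g n)<..} x else 0) \<partial>expo l) =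
      ennreal (exp (- (l * f n))) * (if ?P g then ennreal (exp (l * (z + psum k0 g n))) else 0)"
    proof (cases "?P g")
      case True
      then show ?thesis
        unfolding if_P[OF True] using * by simp
    next
      case False
      show ?thesis unfolding if_not_P[OF False] by simp
    qed
  qed
  also have "\<dots> = ennreal (exp (- (l * f n))) * (ennreal (\<Prod>k<n. l * (e (Suc k) - f k)) * (indicator {..e 0} z * ennreal (exp (l * z))))"
    using ef fe l by (subst nn_integral_psum_box[symmetric]) (auto intro!: nn_integral_cmult)
  finally show ?thesis .
qed

text \<open>
  Palm inversion: the origin is a uniform point of the cell from \<open>0\<close> to the next arrival of a
  size-biased Palm path.
\<close>

definition palm_arrivals :: "real \<Rightarrow> (int \<Rightarrow> real) measure"
  where "palm_arrivals l = distr (density (PiM UNIV (\<lambda>_. expo l) \<Otimes>\<^sub>M lborel) (\<lambda>(g, t). ennreal l * indicator {0..<g 0} t))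
    (PiM UNIV (\<lambda>_. borel)) (\<lambda>(g, t) n. pos g n - t)"

lemma sets_palm_arrivals [measurable_cong]: "sets (palm_arrivals l) = sets (PiM UNIV (\<lambda>_. borel))"
  by (simp add: palm_arrivals_def)

lemma space_palm_arrivals [simp]: "space (palm_arrivals l) = UNIV"
  by (simp add: palm_arrivals_def space_PiM)

lemma nn_integral_palm_arrivals:
  assumes [measurable]: "F \<in> borel_measurable (PiM UNIV (\<lambda>_. borel))"
  shows "(\<integral>\<^sup>+a. F a \<partial>palm_arrivals l) =
    (\<integral>\<^sup>+g. \<integral>\<^sup>+t. ennreal l * indicator {0..<g 0} t * F (\<lambda>n. pos g n - t) \<partial>lborel \<partial>PiM UNIV (\<lambda>_. expo l))"
proof -
  have [measurable]: "(\<lambda>(g, t) n. pos g n - t) \<in> PiM UNIV (\<lambda>_. expo l) \<Otimes>\<^sub>M lborel \<rightarrow>\<^sub>M PiM UNIV (\<lambda>_. borel)"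
    unfolding split_beta' by (rule measurable_PiM_borel_I) measurable
  have [measurable]: "(\<lambda>(g, t). ennreal l * indicator {0..<g 0} t) \<in> borel_measurable (PiM UNIV (\<lambda>_. expo l) \<Otimes>\<^sub>M lborel)"
    unfolding split_beta' by measurable
  have "(\<integral>\<^sup>+a. F a \<partial>palm_arrivals l) = (\<integral>\<^sup>+p. (\<lambda>(g, t). ennreal l * indicator {0..<g 0} t) p *
      F ((\<lambda>(g, t) n. pos g n - t) p) \<partial>(PiM UNIV (\<lambda>_. expo l) \<Otimes>\<^sub>M lborel))"
    unfolding palm_arrivals_def by (subst nn_integral_distr, simp, simp) (subst nn_integral_density; simp)
  also have "\<dots> = (\<integral>\<^sup>+g. \<integral>\<^sup>+t. (\<lambda>(g, t). ennreal l * indicator {0..<g 0} t) (g, t) *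
      F ((\<lambda>(g, t) n. pos g n - t) (g, t)) \<partial>lborel \<partial>PiM UNIV (\<lambda>_. expo l))"
    by (rule lborel.nn_integral_fst[symmetric]) measurable
  finally show ?thesis by simp
qed

text \<open>The mass is \<open>l\<close> times the mean gap, and the mean is the integral of the
  tail.\<close>

lemma prob_space_palm_arrivals:
  assumes l: "0 < l"
  shows "prob_space (palm_arrivals l)"
proof
  interpret L: prob_space "expo l" using l by (rule prob_space_expo)
  interpret G: prob_space "PiM UNIV (\<lambda>_::int. expo l)" by (intro prob_space_PiM L.prob_space_axioms)
  interpret lL: pair_sigma_finite lborel "expo l" ..
  have "emeasure (palm_arrivals l) (space (palm_arrivals l)) = (\<integral>\<^sup>+a. 1 \<partial>palm_arrivals l)" by simp
  also have "\<dots> = (\<integral>\<^sup>+g. \<integral>\<^sup>+t. ennreal l * indicator {0..<g 0} t * 1 \<partial>lborel \<partial>PiM UNIV (\<lambda>_::int. expo l))"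
    by (rule nn_integral_palm_arrivals) measurable
  also have "\<dots> = (\<integral>\<^sup>+x. \<integral>\<^sup>+t. ennreal l * indicator {0..<x} t \<partial>lborel \<partial>expo l)"
    by (subst nn_integral_PiM_resample[where k = 0]) (auto intro: L.prob_space_axioms simp: G.emeasure_space_1)
  also have "\<dots> = (\<integral>\<^sup>+t. \<integral>\<^sup>+x. ennreal l * indicator {0..<x} t \<partial>expo l \<partial>lborel)"
    by (rule lL.Fubini') measurable
  also have "\<dots> = (\<integral>\<^sup>+t. ennreal (l * exp (- (l * t))) * indicator {0..} t * 1 \<partial>lborel)"
  proof (rule nn_integral_cong)
    fix t
    have "(\<integral>\<^sup>+x. ennreal l * indicator {0..<x} t \<partial>expo l) = (\<integral>\<^sup>+x. (ennreal l * indicator {0..} t) * indicator {t<..} x \<partial>expo l)"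
      by (intro nn_integral_cong) (auto simp: indicator_def)
    also have "\<dots> = ennreal l * indicator {0..} t * emeasure (expo l) {t<..}"
      by (subst nn_integral_cmult) auto
    also have "\<dots> = ennreal (l * exp (- (l * t))) * indicator {0..} t * 1"
      using l by (cases "0 \<le> t") (auto simp: emeasure_expo_greaterThan ennreal_mult'')
    finally show "(\<integral>\<^sup>+x. ennreal l * indicator {0..<x} t \<partial>expo l) = \<dots>" .
  qed
  also have "\<dots> = (\<integral>\<^sup>+t. 1 \<partial>expo l)"
    using l by (subst nn_integral_expo) auto
  finally show "emeasure (palm_arrivals l) (space (palm_arrivals l)) = 1"
    using L.emeasure_space_1 by simp
qed

lemma AE_palm_arrivals_numbered:
  assumes l: "0 < l"
  shows "AE a in palm_arrivals l. a \<in> numbered"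
proof -
  have "AE g in PiM UNIV (\<lambda>_::int. expo l). \<forall>i. 0 < g i"
    unfolding AE_all_countable using l by (intro allI AE_PiM_component prob_space_expo AE_expo_pos UNIV_I)
  then have "AE g in PiM UNIV (\<lambda>_::int. expo l).
      (\<integral>\<^sup>+t. ennreal l * indicator {0..<g 0} t * indicator (- numbered) (\<lambda>n. pos g n - t) \<partial>lborel) = 0"
  proof eventually_elim
    case (elim g)
    have "(\<lambda>n. pos g n - t) \<in> numbered" if "0 \<le> t" "t < g 0" for t
      using strict_mono_pos[of g] elim that by (auto simp: numbered_def strict_mono_def)
    then have *: "ennreal l * indicator {0..<g 0} t * indicator (- numbered) (\<lambda>n. pos g n - t) = 0" for t
      by (auto simp: indicator_def)
    show ?case unfolding * by simp
  qed
  moreover have [measurable]: "- numbered \<in> sets (PiM UNIV (\<lambda>_. borel))"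
    using sets.compl_sets[OF sets_numbered] by (simp add: space_PiM Compl_eq_Diff_UNIV)
  ultimately have "(\<integral>\<^sup>+a. indicator (- numbered) a \<partial>palm_arrivals l) = 0"
    by (subst nn_integral_palm_arrivals) (auto simp: nn_integral_0_iff_AE cong: nn_integral_cong_AE)
  then have "emeasure (palm_arrivals l) (- numbered) = 0" by simp
  then show ?thesis by (intro AE_I'[of "- numbered"]) auto
qed

text \<open>The product formula appears once the uniform origin is traded for the position
  \<open>z\<close> of the leftmost constrained point as integration variable.\<close>

lemma emeasure_palm_arrivals_gap_box:
  assumes l: "0 < l" and adm: "admissible k0 n e f" and fe: "\<And>k. k < n \<Longrightarrow> f k \<le> e (Suc k)"
  shows "emeasure (palm_arrivals l) (gap_box k0 n e f) = ennreal (box_prob l n e f)"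
proof -
  let ?G = "PiM UNIV (\<lambda>_::int. expo l)"
  let ?I = "indicator (gap_box k0 n e f) :: (int \<Rightarrow> real) \<Rightarrow> ennreal"
  interpret L: prob_space "expo l" using l by (rule prob_space_expo)
  interpret G: prob_space ?G by (intro prob_space_PiM L.prob_space_axioms)
  interpret Gl: pair_sigma_finite lborel ?G ..
  have ef: "\<And>k. k \<le> n \<Longrightarrow> e k \<le> f k" and "k0 \<le> n" "e k0 \<le> 0" "0 \<le> f k0"
    using adm by (auto simp: admissible_def)
  have [measurable]: "(\<lambda>(z, g) i. z + (pos g i - pos g (- int k0))) \<in> lborel \<Otimes>\<^sub>M ?G \<rightarrow>\<^sub>M PiM UNIV (\<lambda>_. borel)"
    unfolding split_beta' by (rule measurable_PiM_borel_I) measurable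
  have "emeasure (palm_arrivals l) (gap_box k0 n e f) = (\<integral>\<^sup>+a. ?I a \<partial>palm_arrivals l)"
    by simp
  also have "\<dots> = (\<integral>\<^sup>+g. \<integral>\<^sup>+t. ennreal l * indicator {0..<g 0} t * ?I (\<lambda>n. pos g n - t) \<partial>lborel \<partial>?G)"
    by (rule nn_integral_palm_arrivals) measurable
  \<comment> \<open>A path in the box has point \<open>0\<close> at most \<open>e k0 \<le> 0\<close>
    and point \<open>1\<close> above \<open>f k0\<close>, where \<open>0 \<le> f k0\<close>. The
    cell condition on \<open>t\<close> is thus implied, and \<open>t\<close> may range over the
    line.\<close>
  also have "\<dots> = (\<integral>\<^sup>+g. \<integral>\<^sup>+t. ennreal l * ?I (\<lambda>n. pos g n - t) \<partial>lborel \<partial>?G)"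
  proof (intro nn_integral_cong)
    fix g t
    have "0 \<le> t \<and> t < g 0" if "(\<lambda>n. pos g n - t) \<in> gap_box k0 n e f"
    proof -
      have "pos g (int k0 - int k0) - t \<le> e k0 \<and> f k0 < pos g (int k0 - int k0 + 1) - t"
        using that \<open>k0 \<le> n\<close> unfolding gap_box_def by blast
      then show ?thesis using \<open>e k0 \<le> 0\<close> \<open>0 \<le> f k0\<close> by simp
    qed
    then show "ennreal l * indicator {0..<g 0} t * ?I (\<lambda>n. pos g n - t) = ennreal l * ?I (\<lambda>n. pos g n - t)"
      by (auto simp: indicator_def)
  qed
  \<comment> \<open>Substitution \<open>z = pos g (- int k0) - t\<close>; afterwards the range of
    \<open>z\<close> does not depend on \<open>g\<close>, which permits Fubini.\<close>
  also have "\<dots> = (\<integral>\<^sup>+g. \<integral>\<^sup>+z. ennreal l * ?I (\<lambda>i. z + (pos g i - pos g (- int k0))) \<partial>lborel \<partial>?G)"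
  proof (rule nn_integral_cong)
    fix g
    have [measurable]: "(\<lambda>t n. pos g n - t) \<in> borel \<rightarrow>\<^sub>M PiM UNIV (\<lambda>_. borel)"
      by (rule measurable_PiM_borel_I) measurable
    show "(\<integral>\<^sup>+t. ennreal l * ?I (\<lambda>n. pos g n - t) \<partial>lborel) = (\<integral>\<^sup>+z. ennreal l * ?I (\<lambda>i. z + (pos g i - pos g (- int k0))) \<partial>lborel)"
      using nn_integral_real_affine[of "\<lambda>t. ennreal l * ?I (\<lambda>n. pos g n - t)" "- 1" "pos g (- int k0)"]
      by (simp add: algebra_simps)
  qed
  also have "\<dots> = (\<integral>\<^sup>+z. \<integral>\<^sup>+g. ennreal l * ?I (\<lambda>i. z + (pos g i - pos g (- int k0))) \<partial>?G \<partial>lborel)"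
    by (rule Gl.Fubini') measurable
  also have "\<dots> = (\<integral>\<^sup>+z. ennreal l * (ennreal (exp (- (l * f n))) * (ennreal (\<Prod>k<n. l * (e (Suc k) - f k)) *
      (indicator {..e 0} z * ennreal (exp (l * z))))) \<partial>lborel)"
    using nn_integral_gap_box[of l n e f k0, OF l ef fe] by (simp add: nn_integral_cmult)
  \<comment> \<open>The integral over \<open>z\<close> produces \<open>1 / l\<close>, which cancels
    the Palm normalisation.\<close>
  also have "\<dots> = ennreal l * (ennreal (exp (- (l * f n))) * (ennreal (\<Prod>k<n. l * (e (Suc k) - f k)) * ennreal (exp (l * e 0) / l)))"
    using l by (simp add: nn_integral_cmult nn_integral_lborel_exp_atMost)
  also have "\<dots> = ennreal (box_prob l n e f)"
    using l fe by (simp add: box_prob_def ennreal_mult'[symmetric] prod_nonneg exp_diff exp_minus right_diff_distrib field_simps)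
  finally show ?thesis .
qed

section \<open>Gap boxes as counting events of the Poisson process\<close>

lemma num_points_eq_0: "num_points B X = 0 \<longleftrightarrow> X \<inter> B = {}"
  by (simp add: num_points_def emeasure_count_space_eq_0)

lemma num_points_eq_1: "num_points B X = 1 \<longleftrightarrow> (\<exists>x. X \<inter> B = {x})"
proof
  assume *: "num_points B X = 1"
  then have "finite (X \<inter> B)"
    unfolding num_points_def by (rule_tac ccontr) (simp add: emeasure_count_space_infinite)
  with * have "card (X \<inter> B) = 1"
    by (simp add: num_points_def emeasure_count_space_finite)
  then obtain x where "X \<inter> B = {x}" by (rule card_1_singletonE)
  then show "\<exists>x. X \<inter> B = {x}" ..
qed (auto simp: num_points_def emeasure_count_space_finite)

text \<open>The empty interval around the origin identifies gap \<open>0\<close>; from there each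
  interval with exactly one point identifies the neighbouring index, upwards and downwards.\<close>

lemma mem_gap_box_iff:
  assumes a: "a \<in> numbered" and adm: "admissible k0 n e f" and fe: "\<And>k. k < n \<Longrightarrow> f k \<le> e (Suc k)"
  shows "a \<in> gap_box k0 n e f \<longleftrightarrow>
    (\<forall>k\<le>n. num_points {e k<..f k} (range a) = 0) \<and> (\<forall>k<n. num_points {f k<..e (Suc k)} (range a) = 1)"
proof -
  have ef: "\<And>k. k \<le> n \<Longrightarrow> e k \<le> f k" and k0: "k0 \<le> n" "e k0 \<le> 0" "0 \<le> f k0"
    using adm by (auto simp: admissible_def)
  have mono: "strict_mono a" and a01: "a 0 \<le> 0" "0 < a 1"
    using a by (auto simp: numbered_def)
  define b where "b k = a (int k - int k0)" for k
  have b_Suc: "a (int k - int k0 + 1) = b (Suc k)" for k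
    by (simp add: b_def algebra_simps)
  have lt: "b k < b (Suc k)" for k
    unfolding b_Suc[symmetric] unfolding b_def by (rule strict_monoD[OF mono]) simp
  have up: "b (Suc k) \<le> a j" if "b k < a j" for j k
  proof -
    have "int k - int k0 < j" using that by (simp add: b_def strict_mono_less[OF mono])
    then show ?thesis unfolding b_Suc[symmetric] by (simp add: strict_mono_less_eq[OF mono])
  qed
  have down: "a j \<le> b k" if "a j < b (Suc k)" for j k
  proof -
    have "j < int k - int k0 + 1" using that by (simp add: b_Suc[symmetric] strict_mono_less[OF mono])
    then show ?thesis unfolding b_def by (simp add: strict_mono_less_eq[OF mono])
  qed
  have b_range: "b k \<in> range a" for k by (simp add: b_def)
  have box: "a \<in> gap_box k0 n e f \<longleftrightarrow> (\<forall>k\<le>n. b k \<le> e k \<and> f k < b (Suc k))"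
    by (simp add: gap_box_def b_Suc) (simp add: b_def)
  show ?thesis unfolding box
  proof
    assume *: "\<forall>k\<le>n. b k \<le> e k \<and> f k < b (Suc k)"
    then have h: "b k \<le> e k" "f k < b (Suc k)" if "k \<le> n" for k
      using that by auto
    have "range a \<inter> {e k<..f k} = {}" if "k \<le> n" for k
    proof -
      have "\<not> a j \<le> f k" if "e k < a j" for j
        using up[of k j] h[OF \<open>k \<le> n\<close>] that by linarith
      then show ?thesis by auto
    qed
    moreover have "range a \<inter> {f k<..e (Suc k)} = {b (Suc k)}" if "k < n" for k
    proof -
      have k: "k \<le> n" "Suc k \<le> n" using that by auto
      have eq: "a j = b (Suc k)" if "f k < a j" "a j \<le> e (Suc k)" for j
      proof (rule antisym)
        show "b (Suc k) \<le> a j"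
          using up[of k j] h[OF k(1)] ef[OF k(1)] that by linarith
        show "a j \<le> b (Suc k)"
          using down[of j "Suc k"] h[OF k(2)] ef[OF k(2)] that by linarith
      qed
      have mem: "f k < b (Suc k)" "b (Suc k) \<le> e (Suc k)" using h k by auto
      show ?thesis
      proof (intro equalityI subsetI)
        fix x assume "x \<in> range a \<inter> {f k<..e (Suc k)}"
        then obtain j where "x = a j" "f k < a j" "a j \<le> e (Suc k)" by auto
        then show "x \<in> {b (Suc k)}" using eq by simp
      next
        fix x assume "x \<in> {b (Suc k)}"
        then show "x \<in> range a \<inter> {f k<..e (Suc k)}" using b_range[of "Suc k"] mem by simp
      qed
    qed
    ultimately show "(\<forall>k\<le>n. num_points {e k<..f k} (range a) = 0) \<and> (\<forall>k<n. num_points {f k<..e (Suc k)} (range a) = 1)"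
      unfolding num_points_eq_0 num_points_eq_1 by simp
  next
    assume *: "(\<forall>k\<le>n. num_points {e k<..f k} (range a) = 0) \<and> (\<forall>k<n. num_points {f k<..e (Suc k)} (range a) = 1)"
    have gap: "a j \<le> e k \<or> f k < a j" if "k \<le> n" for j k
    proof -
      have "range a \<inter> {e k<..f k} = {}"
        using * that by (simp add: num_points_eq_0)
      then have "a j \<notin> {e k<..f k}" by (metis disjoint_iff rangeI)
      then show ?thesis by (simp add: not_less not_le)
    qed
    have gap': "b i \<le> e k \<or> f k < b i" if "k \<le> n" for i k
      unfolding b_def using that by (rule gap)
    have one: "\<exists>j. f k < a j \<and> a j \<le> e (Suc k) \<and> (\<forall>i. f k < a i \<and> a i \<le> e (Suc k) \<longrightarrow> a i = a j)" if "k < n" for k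
    proof -
      have "\<exists>x. range a \<inter> {f k<..e (Suc k)} = {x}"
        using * that by (simp add: num_points_eq_1)
      then obtain x where x: "range a \<inter> {f k<..e (Suc k)} = {x}" ..
      then have "x \<in> range a \<inter> {f k<..e (Suc k)}" by (simp only: singletonI)
      then obtain j where j: "x = a j" "f k < a j" "a j \<le> e (Suc k)" by auto
      have "a i = a j" if "f k < a i" "a i \<le> e (Suc k)" for i
      proof -
        have "a i \<in> range a \<inter> {f k<..e (Suc k)}" using that by simp
        then show ?thesis unfolding x j(1) by (rule singletonD)
      qed
      with j show ?thesis by blast
    qed
    let ?P = "\<lambda>k. b k \<le> e k \<and> f k < b (Suc k)"
    \<comment> \<open>The interval for \<open>k0\<close> contains the origin and no point, so it
      separates \<open>a 0\<close> from \<open>a 1\<close>.\<close>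
    have base: "?P k0"
    proof -
      have "b k0 = a 0" "b (Suc k0) = a 1" by (simp_all add: b_def)
      then show ?thesis using gap[of k0 0] gap[of k0 1] a01 k0 by auto
    qed
    \<comment> \<open>The unique point above \<open>f k\<close> and up to \<open>e (Suc k)\<close>
      has to be \<open>b (Suc k)\<close>. Its successor lies beyond \<open>e (Suc k)\<close> and,
      the next interval being empty, beyond \<open>f (Suc k)\<close>.\<close>
    have step_up: "?P (Suc k)" if "?P k" "k < n" for k
    proof -
      obtain j where j: "f k < a j" "a j \<le> e (Suc k)" and uniq: "\<And>i. f k < a i \<Longrightarrow> a i \<le> e (Suc k) \<Longrightarrow> a i = a j"
        using one[OF \<open>k < n\<close>] by blast
      have "b (Suc k) \<le> a j"
        using up[of k j] that j ef[of k] by simp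
      then have le: "b (Suc k) \<le> e (Suc k)" using j by simp
      have uniq': "b i = a j" if "f k < b i" "b i \<le> e (Suc k)" for i
        using uniq[of "int i - int k0"] that by (simp add: b_def)
      have "b (Suc k) = a j"
        using uniq'[of "Suc k"] le that by simp
      moreover have "b (Suc (Suc k)) = a j" if "b (Suc (Suc k)) \<le> e (Suc k)"
        using uniq'[of "Suc (Suc k)"] that lt[of "Suc k"] \<open>?P k\<close> by simp
      ultimately have "e (Suc k) < b (Suc (Suc k))"
        using lt[of "Suc k"] by linarith
      then show ?thesis
        using gap'[of "Suc k" "Suc (Suc k)"] ef[of "Suc k"] le that by simp
    qed
    have step_down: "?P k" if "?P (Suc k)" "k < n" for k
    proof -
      obtain j where j: "f k < a j" "a j \<le> e (Suc k)" and uniq: "\<And>i. f k < a i \<Longrightarrow> a i \<le> e (Suc k) \<Longrightarrow> a i = a j"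
        using one[OF \<open>k < n\<close>] by blast
      have "a j \<le> b (Suc k)"
        using down[of j "Suc k"] that j ef[of "Suc k"] by simp
      then have lt': "f k < b (Suc k)" using j by simp
      have uniq': "b i = a j" if "f k < b i" "b i \<le> e (Suc k)" for i
        using uniq[of "int i - int k0"] that by (simp add: b_def)
      have "b (Suc k) = a j"
        using uniq'[of "Suc k"] lt' that by simp
      moreover have "b k = a j" if "f k < b k"
        using uniq'[of k] that lt[of k] \<open>?P (Suc k)\<close> by simp
      ultimately have "b k \<le> f k"
        using lt[of k] by linarith
      then show ?thesis
        using gap'[of k k] lt' that by simp
    qed
    have "?P k" if "k \<le> n" for k
    proof (cases "k0 \<le> k")
      case True
      then show ?thesis using that
      proof (induction k rule: dec_induct)
        case (step i)
        then show ?case using step_up[of i] by simp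
      qed (rule base)
    next
      case False
      then have "k \<le> k0" by simp
      then show ?thesis
      proof (induction k rule: inc_induct)
        case (step i)
        then show ?case using step_down[of i] k0 by simp
      qed (rule base)
    qed
    then show "\<forall>k\<le>n. ?P k" by blast
  qed
qed

lemma all_le_double: "(\<forall>i\<le>2 * n. P i) \<longleftrightarrow> (\<forall>k\<le>n. P (2 * k)) \<and> (\<forall>k<n. P (Suc (2 * k)))" for n :: nat
proof (induction n)
  case (Suc n)
  have "2 * Suc n = Suc (Suc (2 * n))" by simp
  then show ?case
    using Suc.IH by (auto simp: le_Suc_eq less_Suc_eq)
qed simp

text \<open>In the order \<open>e 0\<close>, \<open>f 0\<close>, \<open>e 1\<close>,
  \<open>f 1\<close> and so on, the bounds cut out consecutive disjoint intervals. The box is a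
  condition on their counts, to which independence and the Poisson weights apply.\<close>

lemma emeasure_poisson_gap_box:
  fixes M :: "'w measure"
  assumes "prob_space M" and pp: "poisson_process M l (\<lambda>w. range (\<lambda>n. A n w))"
    and A[measurable]: "\<And>n. A n \<in> borel_measurable M"
    and AE: "AE w in M. (\<lambda>n. A n w) \<in> numbered"
    and l: "0 < l"
    and adm: "admissible k0 n e f" and fe: "\<And>k. k < n \<Longrightarrow> f k \<le> e (Suc k)"
  shows "emeasure M {w \<in> space M. (\<lambda>n. A n w) \<in> gap_box k0 n e f} = ennreal (box_prob l n e f)"
proof -
  interpret prob_space M by fact
  have ef: "\<And>k. k \<le> n \<Longrightarrow> e k \<le> f k" using adm by (auto simp: admissible_def)
  \<comment> \<open>\<open>c\<close> lists the bounds alternately, so that interval \<open>i\<close>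
    must contain \<open>i mod 2\<close> points: even ones lie in gaps, odd ones carry a
    point.\<close>
  define c where "c i = (if even i then e (i div 2) else f (i div 2))" for i
  define B where "B i = {c i<..c (Suc i)}" for i
  let ?X = "\<lambda>w. range (\<lambda>n. A n w)"
  have c: "c (2 * k) = e k" "c (Suc (2 * k)) = f k" "c (Suc (Suc (2 * k))) = e (Suc k)" for k
    by (simp_all add: c_def)
  have c_le: "\<forall>i\<le>2 * n. c i \<le> c (Suc i)"
    unfolding all_le_double c using ef fe by auto
  have c_mono: "c i \<le> c j" if "i \<le> j" "j \<le> Suc (2 * n)" for i j
    using that by (induction j rule: dec_induct) (use c_le in \<open>auto intro: order_trans\<close>)
  have "disjoint_family_on B {..2 * n}"
    unfolding disjoint_family_on_def
  proof (intro ballI impI)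
    fix i j assume ij: "i \<in> {..2 * n}" "j \<in> {..2 * n}" "i \<noteq> j"
    have less: "B i \<inter> B j = {}" if "i < j" "j \<le> 2 * n" for i j
      using c_mono[of "Suc i" j] that by (auto simp: B_def)
    then show "B i \<inter> B j = {}"
      using less[of i j] less[of j i] ij by (cases i j rule: linorder_cases) (simp_all add: Int_commute)
  qed
  moreover have B: "B i \<in> sets borel" "bounded (B i)" for i
    by (auto simp: B_def)
  ultimately have indep: "indep_vars (\<lambda>_. borel) (\<lambda>i w. num_points (B i) (?X w)) {..2 * n}"
    using pp unfolding poisson_process_def by auto
  have count: "prob {w \<in> space M. num_points (B i) (?X w) = of_nat k} =
      (l * (c (Suc i) - c i)) ^ k / fact k * exp (- (l * (c (Suc i) - c i)))" if "i \<le> 2 * n" for i k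
    using pp B[of i] c_le that unfolding poisson_process_def by (simp add: B_def)
  have [measurable]: "(\<lambda>w. num_points (B i) (?X w)) \<in> borel_measurable M" if "i \<in> {..2 * n}" for i
    using indep that by (auto simp: indep_vars_def)
  have "{w \<in> space M. \<forall>i\<le>2 * n. num_points (B i) (?X w) = of_nat (i mod 2)} =
      (\<Inter>i\<in>{..2 * n}. (\<lambda>w. num_points (B i) (?X w)) -` {of_nat (i mod 2)} \<inter> space M)"
    by auto
  then have "prob {w \<in> space M. \<forall>i\<le>2 * n. num_points (B i) (?X w) = of_nat (i mod 2)} =
      (\<Prod>i\<in>{..2 * n}. prob ((\<lambda>w. num_points (B i) (?X w)) -` {of_nat (i mod 2)} \<inter> space M))"
    by (simp only:) (rule indep_varsD_finite[OF indep]; auto)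
  also have "\<dots> = (\<Prod>i\<le>2 * n. (l * (c (Suc i) - c i)) ^ (i mod 2) / fact (i mod 2) * exp (- (l * (c (Suc i) - c i))))"
    by (intro prod.cong refl, subst count[symmetric]) (auto intro!: arg_cong[where f = prob])
  also have "\<dots> = box_prob l n e f"
  proof -
    define q where "q i = (l * (c (Suc i) - c i)) ^ (i mod 2) / fact (i mod 2) * exp (- (l * (c (Suc i) - c i)))" for i
    \<comment> \<open>Passing from \<open>k\<close> to \<open>Suc k\<close> adds one single-point
      interval and one void interval; the exponents telescope.\<close>
    have "(\<Prod>i\<le>2 * k. q i) = box_prob l k e f" for k
    proof (induction k)
      case (Suc k)
      have "Suc (2 * k) mod 2 = 1" "Suc (Suc (2 * k)) mod 2 = 0" by presburger+
      moreover have "c (Suc (Suc (Suc (2 * k)))) = f (Suc k)"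
        using c(2)[of "Suc k"] by simp
      ultimately have q: "q (Suc (2 * k)) = l * (e (Suc k) - f k) * exp (- (l * (e (Suc k) - f k)))"
        "q (Suc (Suc (2 * k))) = exp (- (l * (f (Suc k) - e (Suc k))))"
        unfolding q_def c by simp_all
      have "- (l * (f (Suc k) - e 0)) = - (l * (f k - e 0)) + (- (l * (e (Suc k) - f k)) + - (l * (f (Suc k) - e (Suc k))))"
        by (simp add: algebra_simps)
      then have "exp (- (l * (f (Suc k) - e 0))) =
          exp (- (l * (f k - e 0))) * (exp (- (l * (e (Suc k) - f k))) * exp (- (l * (f (Suc k) - e (Suc k)))))"
        by (simp only: exp_add)
      moreover have "2 * Suc k = Suc (Suc (2 * k))" by simp
      ultimately show ?case
        unfolding box_prob_def[of l "Suc k"]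
        by (simp only: prod.atMost_Suc Suc.IH q) (simp only: box_prob_def prod.lessThan_Suc mult_ac)
    qed (simp add: box_prob_def q_def c_def)
    then show ?thesis by (simp only: q_def)
  qed
  finally have *: "prob {w \<in> space M. \<forall>i\<le>2 * n. num_points (B i) (?X w) = of_nat (i mod 2)} = box_prob l n e f" .
  have "(\<forall>i\<le>2 * n. num_points (B i) (?X w) = of_nat (i mod 2)) \<longleftrightarrow> (\<lambda>n. A n w) \<in> gap_box k0 n e f"
    if "(\<lambda>n. A n w) \<in> numbered" for w
    using mem_gap_box_iff[OF that adm] fe unfolding all_le_double B_def c by simp
  then have "emeasure M {w \<in> space M. (\<lambda>n. A n w) \<in> gap_box k0 n e f} =
      emeasure M {w \<in> space M. \<forall>i\<le>2 * n. num_points (B i) (?X w) = of_nat (i mod 2)}"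
    using AE
  proof (intro emeasure_eq_AE)
    have [measurable]: "(\<lambda>w n. A n w) \<in> M \<rightarrow>\<^sub>M PiM UNIV (\<lambda>_. borel)"
      by (rule measurable_PiM_borel_I) measurable
    show "{w \<in> space M. (\<lambda>n. A n w) \<in> gap_box k0 n e f} \<in> sets M" by measurable
    have "{w \<in> space M. \<forall>i\<in>{..2 * n}. num_points (B i) (?X w) = of_nat (i mod 2)} \<in> sets M"
      by (intro sets.sets_Collect_finite_All) auto
    then show "{w \<in> space M. \<forall>i\<le>2 * n. num_points (B i) (?X w) = of_nat (i mod 2)} \<in> sets M" by simp
  qed (auto elim!: eventually_mono)
  then show ?thesis using * by (simp add: emeasure_eq_measure)
qed

text \<open>Boxes whose bounds are out of order are empty; on all others both laws give
  \<open>box_prob\<close>.\<close>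

lemma distr_poisson_arrivals:
  fixes M :: "'w measure"
  assumes "prob_space M" and pp: "poisson_process M l (\<lambda>w. range (\<lambda>n. A n w))"
    and A: "\<And>n. A n \<in> borel_measurable M"
    and AE: "AE w in M. (\<lambda>n. A n w) \<in> numbered"
    and l: "0 < l"
  shows "distr M (PiM UNIV (\<lambda>_. borel)) (\<lambda>w n. A n w) = palm_arrivals l"
proof (rule measure_eq_on_numbered)
  interpret prob_space M by fact
  have m[measurable]: "(\<lambda>w n. A n w) \<in> M \<rightarrow>\<^sub>M PiM UNIV (\<lambda>_. borel)"
    using A by (rule measurable_PiM_borel_I)
  show "prob_space (distr M (PiM UNIV (\<lambda>_. borel)) (\<lambda>w n. A n w))"
    using m by (rule prob_space_distr)
  show "prob_space (palm_arrivals l)" using l by (rule prob_space_palm_arrivals)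
  show "AE a in palm_arrivals l. a \<in> numbered" using l by (rule AE_palm_arrivals_numbered)
  show "AE a in distr M (PiM UNIV (\<lambda>_. borel)) (\<lambda>w n. A n w). a \<in> numbered"
    using AE by (subst AE_distr_iff) (auto simp: space_PiM)
  fix k0 n e f assume adm: "admissible k0 n e f"
  show "emeasure (distr M (PiM UNIV (\<lambda>_. borel)) (\<lambda>w n. A n w)) (gap_box k0 n e f) = emeasure (palm_arrivals l) (gap_box k0 n e f)"
  proof (cases "\<forall>k<n. f k \<le> e (Suc k)")
    case True
    then have "emeasure (palm_arrivals l) (gap_box k0 n e f) = ennreal (box_prob l n e f)"
      using l adm by (intro emeasure_palm_arrivals_gap_box) auto
    also have "\<dots> = emeasure M {w \<in> space M. (\<lambda>n. A n w) \<in> gap_box k0 n e f}"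
      using assms adm True by (intro emeasure_poisson_gap_box[symmetric]) auto
    finally show ?thesis
      by (simp add: emeasure_distr vimage_def Int_def conj_commute)
  next
    case False
    then have "gap_box k0 n e f = {}" using gap_box_empty[of _ n e f k0] by (auto simp: not_le)
    then show ?thesis by simp
  qed
qed (simp_all add: sets_palm_arrivals)

section \<open>Transfer from the given probability space to the Palm space\<close>

context stable_queue begin

lemma nn_integral_Q_split:
  assumes [measurable]: "F \<in> borel_measurable Q"
  shows "(\<integral>\<^sup>+w. F w \<partial>Q) = (\<integral>\<^sup>+g. \<integral>\<^sup>+s. F (case_sum g s) \<partial>PiM UNIV (\<lambda>_. expo m) \<partial>PiM UNIV (\<lambda>_. expo l))"
proof -
  let ?G = "PiM UNIV (\<lambda>_::int. expo l)" and ?S = "PiM UNIV (\<lambda>_::int. expo m)"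
  interpret L: prob_space "expo l" using l by (rule prob_space_expo)
  interpret M: prob_space "expo m" using l l_less by (intro prob_space_expo) simp
  interpret Gp: prob_space ?G by (intro prob_space_PiM L.prob_space_axioms)
  interpret Sp: prob_space ?S by (intro prob_space_PiM M.prob_space_axioms)
  interpret G: product_prob_space "\<lambda>_::int. expo l" UNIV ..
  interpret S: product_prob_space "\<lambda>_::int. expo m" UNIV ..
  interpret GS: pair_prob_space ?G ?S ..
  have [measurable]: "(\<lambda>(g, s). case_sum g s) \<in> ?G \<Otimes>\<^sub>M ?S \<rightarrow>\<^sub>M Q"
  proof (rule measurable_Q_I)
    show "(\<lambda>x. (case x of (g, s) \<Rightarrow> case_sum g s) c) \<in> borel_measurable (?G \<Otimes>\<^sub>M ?S)" for c
      unfolding split_beta' by (cases c) (simp_all, measurable)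
  qed
  have "distr (?G \<Otimes>\<^sub>M ?S) Q (\<lambda>(g, s). case_sum g s) = Q"
  proof (rule measure_eqI_PiM_infinite[where M = "\<lambda>c. expo (rate c)" and I = UNIV])
    show "sets (distr (?G \<Otimes>\<^sub>M ?S) Q (\<lambda>(g, s). case_sum g s)) = sets (PiM UNIV (\<lambda>c. expo (rate c)))" "sets Q = sets (PiM UNIV (\<lambda>c. expo (rate c)))"
      by (simp_all add: Q_def)
    interpret D: prob_space "distr (?G \<Otimes>\<^sub>M ?S) Q (\<lambda>(g, s). case_sum g s)"
      by (rule GS.prob_space_distr) measurable
    show "finite_measure (distr (?G \<Otimes>\<^sub>M ?S) Q (\<lambda>(g, s). case_sum g s))"
      by (rule D.finite_measure_axioms)
    fix A and J :: "(int + int) set" assume J: "finite J" and A: "\<And>c. c \<in> J \<Longrightarrow> A c \<in> sets (expo (rate c))"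
    define C where "C = prod_emb UNIV (\<lambda>c. expo (rate c)) J (Pi\<^sub>E J A)"
    have C: "w \<in> C \<longleftrightarrow> (\<forall>c\<in>J. w c \<in> A c)" for w
      by (auto simp: C_def prod_emb_def PiE_iff)
    have [measurable]: "C \<in> sets Q"
      unfolding C_def Q_def using J A by (intro sets_PiM_I) auto
    define JL JR where "JL = Inl -` J" and "JR = Inr -` J"
    have fin: "finite JL" "finite JR"
      unfolding JL_def JR_def using J by (auto intro!: finite_vimageI)
    have J_eq: "J = JL <+> JR"
    proof (rule set_eqI)
      show "c \<in> J \<longleftrightarrow> c \<in> JL <+> JR" for c
        by (cases c) (auto simp: JL_def JR_def)
    qed
    let ?L = "{g \<in> space ?G. \<forall>j\<in>JL. g j \<in> A (Inl j)}" and ?R = "{s \<in> space ?S. \<forall>j\<in>JR. s j \<in> A (Inr j)}"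
    have L: "?L \<in> sets ?G" "emeasure ?G ?L = (\<Prod>j\<in>JL. emeasure (expo l) (A (Inl j)))"
    proof -
      have [measurable]: "A (Inl j) \<in> sets borel" if "j \<in> JL" for j
        using A[of "Inl j"] that by (simp add: JL_def)
      show "?L \<in> sets ?G" using fin by measurable
      show "emeasure ?G ?L = (\<Prod>j\<in>JL. emeasure (expo l) (A (Inl j)))"
        using fin by (intro G.emeasure_PiM_Collect) auto
    qed
    have R: "?R \<in> sets ?S" "emeasure ?S ?R = (\<Prod>j\<in>JR. emeasure (expo m) (A (Inr j)))"
    proof -
      have [measurable]: "A (Inr j) \<in> sets borel" if "j \<in> JR" for j
        using A[of "Inr j"] that by (simp add: JR_def)
      show "?R \<in> sets ?S" using fin by measurable
      show "emeasure ?S ?R = (\<Prod>j\<in>JR. emeasure (expo m) (A (Inr j)))"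
        using fin by (intro S.emeasure_PiM_Collect) auto
    qed
    have "(\<forall>c\<in>J. case_sum g s c \<in> A c) \<longleftrightarrow> (\<forall>j\<in>JL. g j \<in> A (Inl j)) \<and> (\<forall>j\<in>JR. s j \<in> A (Inr j))" for g s
      unfolding J_eq by (simp add: Plus_def ball_Un)
    then have "(\<lambda>(g, s). case_sum g s) -` C \<inter> space (?G \<Otimes>\<^sub>M ?S) = ?L \<times> ?R"
      by (auto simp: C space_pair_measure space_PiM)
    then have "emeasure (distr (?G \<Otimes>\<^sub>M ?S) Q (\<lambda>(g, s). case_sum g s)) C = emeasure ?G ?L * emeasure ?S ?R"
      using L R by (simp add: emeasure_distr Sp.emeasure_pair_measure_Times)
    also have "\<dots> = (\<Prod>c\<in>J. emeasure (expo (rate c)) (A c))"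
      unfolding L R J_eq using fin by (simp add: prod.Plus comp_def)
    also have "\<dots> = emeasure Q C"
      unfolding C_def Q_def using J A prob_space_rate by (intro emeasure_PiM_emb[symmetric]) auto
    finally show "emeasure (distr (?G \<Otimes>\<^sub>M ?S) Q (\<lambda>(g, s). case_sum g s)) (prod_emb UNIV (\<lambda>c. expo (rate c)) J (Pi\<^sub>E J A)) =
        emeasure Q (prod_emb UNIV (\<lambda>c. expo (rate c)) J (Pi\<^sub>E J A))"
      by (simp only: C_def)
  qed
  then have "(\<integral>\<^sup>+w. F w \<partial>Q) = (\<integral>\<^sup>+w. F w \<partial>distr (?G \<Otimes>\<^sub>M ?S) Q (\<lambda>(g, s). case_sum g s))" by simp
  also have "\<dots> = (\<integral>\<^sup>+p. F ((\<lambda>(g, s). case_sum g s) p) \<partial>(?G \<Otimes>\<^sub>M ?S))"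
    by (rule nn_integral_distr) measurable
  also have "\<dots> = (\<integral>\<^sup>+g. \<integral>\<^sup>+s. F ((\<lambda>(g, s). case_sum g s) (g, s)) \<partial>?S \<partial>?G)"
    by (rule Sp.nn_integral_fst[symmetric]) measurable
  finally show ?thesis by simp
qed

text \<open>By independence the size-biasing of the cell at the origin affects the gaps only. The
  services keep their product law, and both families merge into \<open>Q\<close>.\<close>

lemma nn_integral_arrivals_services:
  fixes M :: "'w measure" and A s :: "int \<Rightarrow> 'w \<Rightarrow> real"
  assumes "prob_space M"
    and arr: "distr M (PiM UNIV (\<lambda>_. borel)) (\<lambda>w n. A n w) = palm_arrivals l"
    and srv: "distr M (PiM UNIV (\<lambda>_. borel)) (\<lambda>w n. s n w) = PiM UNIV (\<lambda>_. expo m)"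
    and ind: "prob_space.indep_var M
           (PiM UNIV (\<lambda>_. borel)) (\<lambda>w n. A n w)
           (PiM UNIV (\<lambda>_. borel)) (\<lambda>w n. s n w)"
    and F[measurable]: "F \<in> borel_measurable (PiM UNIV (\<lambda>_. borel) \<Otimes>\<^sub>M PiM UNIV (\<lambda>_. borel))"
  shows "(\<integral>\<^sup>+w. F (\<lambda>n. A n w, \<lambda>n. s n w) \<partial>M) =
    ennreal l * (\<integral>\<^sup>+w. \<integral>\<^sup>+t. indicator {0..<w (Inl 0)} t * F (\<lambda>n. pos (gap w) n - t, serv w) \<partial>lborel \<partial>Q)"
proof -
  interpret prob_space M by fact
  let ?P = "PiM UNIV (\<lambda>_. borel) :: (int \<Rightarrow> real) measure"
  let ?G = "PiM UNIV (\<lambda>_. expo l) :: (int \<Rightarrow> real) measure" and ?S = "PiM UNIV (\<lambda>_. expo m) :: (int \<Rightarrow> real) measure"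
  interpret S: prob_space ?S
    using l l_less by (intro prob_space_PiM prob_space_expo) simp
  interpret lS: pair_sigma_finite lborel ?S ..
  have [measurable_cong]: "sets ?S = sets ?P" "sets ?G = sets ?P"
    by (intro sets_PiM_cong; simp)+
  have eq: "distr M ?P (\<lambda>w n. A n w) \<Otimes>\<^sub>M distr M ?P (\<lambda>w n. s n w) = distr M (?P \<Otimes>\<^sub>M ?P) (\<lambda>w. (\<lambda>n. A n w, \<lambda>n. s n w))"
    and [measurable]: "(\<lambda>w n. A n w) \<in> M \<rightarrow>\<^sub>M ?P" "(\<lambda>w n. s n w) \<in> M \<rightarrow>\<^sub>M ?P"
    using ind unfolding indep_var_distribution_eq by auto
  have [measurable]: "(\<lambda>(g, t) n. pos g n - t) \<in> ?P \<Otimes>\<^sub>M borel \<rightarrow>\<^sub>M ?P"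
    unfolding split_beta' by (rule measurable_PiM_borel_I) measurable
  have [measurable]: "gap \<in> Q \<rightarrow>\<^sub>M ?P" "serv \<in> Q \<rightarrow>\<^sub>M ?P"
    by (rule measurable_PiM_borel_I, measurable)+
  have "(\<integral>\<^sup>+w. F (\<lambda>n. A n w, \<lambda>n. s n w) \<partial>M) = (\<integral>\<^sup>+p. F p \<partial>(palm_arrivals l \<Otimes>\<^sub>M ?S))"
    unfolding arr[symmetric] srv[symmetric] eq by (rule nn_integral_distr[symmetric]) measurable
  also have "\<dots> = (\<integral>\<^sup>+a. \<integral>\<^sup>+s. F (a, s) \<partial>?S \<partial>palm_arrivals l)"
    by (rule S.nn_integral_fst[symmetric]) measurable
  also have "\<dots> = (\<integral>\<^sup>+g. \<integral>\<^sup>+t. ennreal l * indicator {0..<g 0} t * (\<integral>\<^sup>+s. F (\<lambda>n. pos g n - t, s) \<partial>?S) \<partial>lborel \<partial>?G)"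
    by (rule nn_integral_palm_arrivals) measurable
  also have "\<dots> = (\<integral>\<^sup>+g. \<integral>\<^sup>+t. \<integral>\<^sup>+s. ennreal l * (indicator {0..<g 0} t * F (\<lambda>n. pos g n - t, s)) \<partial>?S \<partial>lborel \<partial>?G)"
  proof (intro nn_integral_cong)
    fix g :: "int \<Rightarrow> real" and t :: real
    have [measurable]: "(\<lambda>s. F (\<lambda>n. pos g n - t, s)) \<in> borel_measurable ?S"
      by (rule measurable_compose[OF _ F], rule measurable_Pair) (auto simp: space_PiM)
    show "ennreal l * indicator {0..<g 0} t * (\<integral>\<^sup>+s. F (\<lambda>n. pos g n - t, s) \<partial>?S) =
        (\<integral>\<^sup>+s. ennreal l * (indicator {0..<g 0} t * F (\<lambda>n. pos g n - t, s)) \<partial>?S)"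
      by (simp add: nn_integral_cmult mult.assoc)
  qed
  also have "\<dots> = (\<integral>\<^sup>+g. \<integral>\<^sup>+s. \<integral>\<^sup>+t. ennreal l * (indicator {0..<g 0} t * F (\<lambda>n. pos g n - t, s)) \<partial>lborel \<partial>?S \<partial>?G)"
  proof (intro nn_integral_cong)
    fix g :: "int \<Rightarrow> real"
    have [measurable]: "(\<lambda>t n. pos g n - t) \<in> borel \<rightarrow>\<^sub>M ?P"
      by (rule measurable_PiM_borel_I) measurable
    show "(\<integral>\<^sup>+t. \<integral>\<^sup>+s. ennreal l * (indicator {0..<g 0} t * F (\<lambda>n. pos g n - t, s)) \<partial>?S \<partial>lborel) =
        (\<integral>\<^sup>+s. \<integral>\<^sup>+t. ennreal l * (indicator {0..<g 0} t * F (\<lambda>n. pos g n - t, s)) \<partial>lborel \<partial>?S)"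
      by (rule lS.Fubini'[symmetric]) measurable
  qed
  also have "\<dots> = (\<integral>\<^sup>+w. \<integral>\<^sup>+t. ennreal l * (indicator {0..<w (Inl 0)} t * F (\<lambda>n. pos (gap w) n - t, serv w)) \<partial>lborel \<partial>Q)"
    by (subst nn_integral_Q_split) simp_all
  also have "\<dots> = (\<integral>\<^sup>+w. ennreal l * (\<integral>\<^sup>+t. indicator {0..<w (Inl 0)} t * F (\<lambda>n. pos (gap w) n - t, serv w) \<partial>lborel) \<partial>Q)"
  proof (rule nn_integral_cong)
    fix w :: "int + int \<Rightarrow> real"
    have [measurable]: "(\<lambda>t n. pos (gap w) n - t) \<in> borel \<rightarrow>\<^sub>M ?P"
      by (rule measurable_PiM_borel_I) measurable
    have [measurable]: "(\<lambda>t. F (\<lambda>n. pos (gap w) n - t, serv w)) \<in> borel_measurable lborel"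
      by (rule measurable_compose[OF _ F], rule measurable_Pair) (auto simp: space_PiM)
    show "(\<integral>\<^sup>+t. ennreal l * (indicator {0..<w (Inl 0)} t * F (\<lambda>n. pos (gap w) n - t, serv w)) \<partial>lborel) =
        ennreal l * (\<integral>\<^sup>+t. indicator {0..<w (Inl 0)} t * F (\<lambda>n. pos (gap w) n - t, serv w) \<partial>lborel)"
      by (rule nn_integral_cmult) measurable
  qed
  also have "\<dots> = ennreal l * (\<integral>\<^sup>+w. \<integral>\<^sup>+t. indicator {0..<w (Inl 0)} t * F (\<lambda>n. pos (gap w) n - t, serv w) \<partial>lborel \<partial>Q)"
    by (rule nn_integral_cmult) measurable
  finally show ?thesis .
qed

end

theorem theorem1:
  fixes M :: "'w measure" and A s :: "int \<Rightarrow> 'w \<Rightarrow> real" and l \<mu> :: real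
  assumes "prob_space M"
    and "0 < l" and "l < \<mu>"
    and "poisson_process M l (\<lambda>w. {A n w | n. True})"
    and "AE w in M. strict_mono (\<lambda>n. A n w) \<and> A 0 w < 0 \<and> 0 < A 1 w"
    and "\<And>n. distributed M lborel (s n) (exponential_density \<mu>)"
    and "prob_space.indep_vars M (\<lambda>_. borel) s UNIV"
    and "prob_space.indep_var M
           (PiM UNIV (\<lambda>_. borel)) (\<lambda>w n. A n w)
           (PiM UNIV (\<lambda>_. borel)) (\<lambda>w n. s n w)"
  shows "(AE w in M. \<forall>n. \<bar>departure (\<lambda>k. A k w) (\<lambda>k. s k w) n\<bar> \<noteq> \<infinity>) \<and>
    (\<lambda>w. departure_config (\<lambda>k. A k w) (\<lambda>k. s k w)) \<in> measurable M config_space \<and>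
    (\<lambda>w. arrival_config (\<lambda>k. A k w) (\<lambda>k. s k w)) \<in> measurable M config_space \<and>
    distr M config_space (\<lambda>w. departure_config (\<lambda>k. A k w) (\<lambda>k. s k w)) =
    distr M config_space (\<lambda>w. arrival_config (\<lambda>k. A k w) (\<lambda>k. s k w))"
proof -
  interpret prob_space M by fact
  interpret stable_queue l \<mu> by standard fact+
  let ?P = "PiM UNIV (\<lambda>_. borel) :: (int \<Rightarrow> real) measure"
  have "(\<lambda>w n. A n w) \<in> M \<rightarrow>\<^sub>M ?P" and s_PiM: "(\<lambda>w n. s n w) \<in> M \<rightarrow>\<^sub>M ?P"
    using assms(8) unfolding indep_var_distribution_eq by auto
  then have [measurable]: "A n \<in> borel_measurable M" "s n \<in> borel_measurable M" for n
    using measurable_compose[OF _ measurable_component_singleton[of n UNIV "\<lambda>_. borel"]] by fastforce+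
  have "AE w in M. (\<lambda>n. A n w) \<in> numbered"
    using assms(5) by eventually_elim (simp add: numbered_def)
  moreover have "{A n w | n. True} = range (\<lambda>n. A n w)" for w by auto
  ultimately have arr: "distr M ?P (\<lambda>w n. A n w) = palm_arrivals l"
    using assms(1,2,4) by (intro distr_poisson_arrivals) auto
  have "distr M ?P (\<lambda>w. \<lambda>n\<in>UNIV. s n w) = PiM UNIV (\<lambda>n. distr M borel (s n))"
    using assms(7) by (subst (asm) indep_vars_iff_distr_eq_PiM) auto
  moreover have "distr M borel (s n) = expo \<mu>" for n
    using distributed_distr_eq_density[OF assms(6), of n]
    by (simp add: expo_def cong: distr_cong)
  ultimately have srv: "distr M ?P (\<lambda>w n. s n w) = PiM UNIV (\<lambda>_. expo \<mu>)"
    by (simp add: restrict_UNIV)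
  note transfer = nn_integral_arrivals_services[OF assms(1) arr srv assms(8)]
  have dep[measurable]: "(\<lambda>p. departure_config (fst p) (snd p)) \<in> ?P \<Otimes>\<^sub>M ?P \<rightarrow>\<^sub>M config_space"
    by (rule measurable_departure_config) measurable
  have arrc[measurable]: "(\<lambda>p. arrival_config (fst p) (snd p)) \<in> ?P \<Otimes>\<^sub>M ?P \<rightarrow>\<^sub>M config_space"
    by (rule measurable_arrival_config) measurable
  have dep_M[measurable]: "(\<lambda>w. departure_config (\<lambda>k. A k w) (\<lambda>k. s k w)) \<in> M \<rightarrow>\<^sub>M config_space"
    by (rule measurable_departure_config) measurable
  have arr_M[measurable]: "(\<lambda>w. arrival_config (\<lambda>k. A k w) (\<lambda>k. s k w)) \<in> M \<rightarrow>\<^sub>M config_space"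
    by (rule measurable_arrival_config) measurable
  \<comment> \<open>Finiteness uses the same transfer: the indicator of failure is integrated, and
    on stable paths it vanishes for every \<open>t\<close>.\<close>
  have "(\<integral>\<^sup>+w. (if \<forall>n. \<bar>departure (\<lambda>k. A k w) (\<lambda>k. s k w) n\<bar> \<noteq> \<infinity> then 0 else 1) \<partial>M) =
     ennreal l * (\<integral>\<^sup>+w. \<integral>\<^sup>+t. indicator {0..<w (Inl 0)} t *
       (if \<forall>n. \<bar>departure (\<lambda>k. pos (gap w) k - t) (serv w) n\<bar> \<noteq> \<infinity> then 0 else 1) \<partial>lborel \<partial>Q)"
    using transfer[of "\<lambda>p. if \<forall>n. \<bar>departure (fst p) (snd p) n\<bar> \<noteq> \<infinity> then 0 else 1"] by simp
  also have "(\<integral>\<^sup>+w. \<integral>\<^sup>+t. indicator {0..<w (Inl 0)} t *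
       (if \<forall>n. \<bar>departure (\<lambda>k. pos (gap w) k - t) (serv w) n\<bar> \<noteq> \<infinity> then 0 else 1) \<partial>lborel \<partial>Q) = (\<integral>\<^sup>+w. 0 \<partial>Q)"
  proof (rule nn_integral_cong_AE, use AE_Q_stable in eventually_elim)
    case (elim w)
    have "\<bar>departure (\<lambda>k. pos (gap w) k - t) (serv w) n\<bar> \<noteq> \<infinity>" for t n
      using stable_departure_finite[OF elim, of n] unfolding departure_translate
      by (cases "departure (pos (gap w)) (serv w) n") auto
    then show ?case by simp
  qed
  finally have 0: "(\<integral>\<^sup>+w. (if \<forall>n. \<bar>departure (\<lambda>k. A k w) (\<lambda>k. s k w) n\<bar> \<noteq> \<infinity> then 0 else 1) \<partial>M) = 0"
    by simp
  have [measurable]: "(\<lambda>w. \<bar>departure (\<lambda>k. A k w) (\<lambda>k. s k w) n\<bar>) \<in> borel_measurable M" for n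
    by measurable
  have "AE w in M. (if \<forall>n. \<bar>departure (\<lambda>k. A k w) (\<lambda>k. s k w) n\<bar> \<noteq> \<infinity> then 0 else 1 :: ennreal) = 0"
    by (subst nn_integral_0_iff_AE[symmetric]) (measurable, rule 0)
  then have fin: "AE w in M. \<forall>n. \<bar>departure (\<lambda>k. A k w) (\<lambda>k. s k w) n\<bar> \<noteq> \<infinity>"
    by eventually_elim (simp split: if_splits)
  have "distr M config_space (\<lambda>w. departure_config (\<lambda>k. A k w) (\<lambda>k. s k w)) =
    distr M config_space (\<lambda>w. arrival_config (\<lambda>k. A k w) (\<lambda>k. s k w))"
  proof (rule measure_eqI)
    fix C assume "C \<in> sets (distr M config_space (\<lambda>w. departure_config (\<lambda>k. A k w) (\<lambda>k. s k w)))"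
    then have [measurable]: "C \<in> sets config_space" by simp
    have "emeasure (distr M config_space (\<lambda>w. departure_config (\<lambda>k. A k w) (\<lambda>k. s k w))) C =
        (\<integral>\<^sup>+w. indicator C (departure_config (\<lambda>k. A k w) (\<lambda>k. s k w)) \<partial>M)"
      by (subst nn_integral_indicator[symmetric], simp) (rule nn_integral_distr; simp)
    \<comment> \<open>Both sides become Palm integrals with the same factor \<open>l\<close>, which
      were equated by the exchange of cells.\<close>
    also have "\<dots> = (\<integral>\<^sup>+w. indicator C (arrival_config (\<lambda>k. A k w) (\<lambda>k. s k w)) \<partial>M)"
      using transfer[of "\<lambda>p. indicator C (departure_config (fst p) (snd p))"]
        transfer[of "\<lambda>p. indicator C (arrival_config (fst p) (snd p))"]
        departure_config_eq_arrival_config_palm[of C] by simp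
    also have "\<dots> = emeasure (distr M config_space (\<lambda>w. arrival_config (\<lambda>k. A k w) (\<lambda>k. s k w))) C"
      by (subst nn_integral_indicator[symmetric], simp) (rule nn_integral_distr[symmetric]; simp)
    finally show "emeasure (distr M config_space (\<lambda>w. departure_config (\<lambda>k. A k w) (\<lambda>k. s k w))) C =
        emeasure (distr M config_space (\<lambda>w. arrival_config (\<lambda>k. A k w) (\<lambda>k. s k w))) C" .
  qed simp
  with fin dep_M arr_M show ?thesis by blast
qed

end
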